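(* Let $n\ge 1$, let $f\in R=\mathbb{C}[x_0,\dots,x_n]$ be a homogeneous polynomial of degree $d\geq 2$ such that $X=V(f)\subset\mathbb{P}^n$ is not a cone, and let $A=A(f)$. Let $k\le\lfloor d/2\rfloor$ be the greatest integer such that $\bullet L:A_{k-1}\to A_k$ is injective for some $L\in A_1$. Then for each $1\le j\le k$: if the relative $j$-th polar map $\varphi^j$ is degenerated, then $\operatorname{hess}_f^j=0$.
   Context: $X=V(f)$ is a cone if, up to a linear change of coordinates, $f$ depends only on $x_1,\dots,x_n$. Let $Q=\mathbb{C}[X_0,\dots,X_n]$ act on $R$ by differentiation, $X_i=\partial/\partial x_i$; write $\alpha(f)$ for the action of $\alpha\in Q$ on $f$. Set $\operatorname{Ann}(f)=\{\alpha\in Q:\alpha(f)=0\}$ and $A=A(f)=Q/\operatorname{Ann}(f)=\bigoplus_{i=0}^d A_i$, a standard graded Artinian Gorenstein algebra of socle degree $d$; elements of $A$ act on $f$. For a basis $(\alpha_1,\dots,\alpha_{a_j})$ of $A_j$, the $j$-th Hessian matrix is $\operatorname{Hess}_f^j=[\alpha_i\alpha_l(f)]_{i,l}$ and $\operatorname{hess}_f^j=\det\operatorname{Hess}_f^j$ (its vanishing does not depend on the basis). The relative $j$-th polar map is the rational map $\varphi^j=\varphi_X^j:\mathbb{P}^n\dashrightarrow\mathbb{P}^{a_j-1}$, $p\mapsto(\alpha_1(f)(p):\dots:\alpha_{a_j}(f)(p))$, with image closure $Z_j=\overline{\varphi^j(\mathbb{P}^n)}$; it is called degenerated if $\dim Z_j<n$.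 *)

theory Defs
  imports
    "HOL-Library.Poly_Mapping"
    "HOL-Library.Extended_Nat"
    "HOL-Analysis.Abstract_Topology"
    "HOL-Algebra.QuotRing"
    "HOL-Algebra.Embedded_Algebras"
    "Jordan_Normal_Form.Determinant"
begin

section \<open>Polynomials in the variables \<open>x\<^sub>0, \<dots>, x\<^bsub>m-1\<^esub>\<close>\<close>

type_synonym mpoly = "(nat \<Rightarrow>\<^sub>0 nat) \<Rightarrow>\<^sub>0 complex"

definition Const :: "complex \<Rightarrow> mpoly" where
  "Const c = Poly_Mapping.single 0 c"

definition Var :: "nat \<Rightarrow> mpoly" where
  "Var i = Poly_Mapping.single (Poly_Mapping.single i 1) 1"

definition pvars :: "mpoly \<Rightarrow> nat set" where
  "pvars p = (\<Union>a\<in>Poly_Mapping.keys p. Poly_Mapping.keys a)"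

definition mpolys :: "nat \<Rightarrow> mpoly set" where
  "mpolys m = {p. pvars p \<subseteq> {..<m}}"

definition mpoly_ring :: "nat \<Rightarrow> mpoly ring" where
  "mpoly_ring m = \<lparr>carrier = mpolys m, monoid.mult = (*), one = 1, zero = 0, add = (+)\<rparr>"

definition homogeneous :: "nat \<Rightarrow> mpoly \<Rightarrow> bool" where
  "homogeneous d p \<longleftrightarrow>
     (\<forall>a\<in>Poly_Mapping.keys p. (\<Sum>i\<in>Poly_Mapping.keys a. Poly_Mapping.lookup a i) = d)"

definition peval :: "(nat \<Rightarrow> complex) \<Rightarrow> mpoly \<Rightarrow> complex" where
  "peval v p = (\<Sum>a\<in>Poly_Mapping.keys p.
     Poly_Mapping.lookup p a * (\<Prod>i\<in>Poly_Mapping.keys a. v i ^ Poly_Mapping.lookup a i))"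

definition lin_subst :: "complex mat \<Rightarrow> mpoly \<Rightarrow> mpoly" where
  "lin_subst M p = (\<Sum>a\<in>Poly_Mapping.keys p. Const (Poly_Mapping.lookup p a) *
     (\<Prod>i\<in>Poly_Mapping.keys a.
        (\<Sum>l<dim_col M. Const (M $$ (i, l)) * Var l) ^ Poly_Mapping.lookup a i))"

definition is_cone :: "nat \<Rightarrow> mpoly \<Rightarrow> bool" where
  "is_cone n f \<longleftrightarrow>
     (\<exists>M\<in>carrier_mat (Suc n) (Suc n). invertible_mat M \<and> pvars (lin_subst M f) \<subseteq> {1..n})"

section \<open>The action by differentiation and the algebra \<open>A(f)\<close>\<close>

text \<open>In \<open>pdiff\<close> the exponent subtraction is truncated, but where it truncates the coefficient is zero.\<close>

definition pdiff :: "nat \<Rightarrow> mpoly \<Rightarrow> mpoly" where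
  "pdiff i p = (\<Sum>a\<in>Poly_Mapping.keys p.
     Poly_Mapping.single (a - Poly_Mapping.single i 1)
       (of_nat (Poly_Mapping.lookup a i) * Poly_Mapping.lookup p a))"

definition monom_act :: "(nat \<Rightarrow>\<^sub>0 nat) \<Rightarrow> mpoly \<Rightarrow> mpoly" where
  "monom_act a = fold (\<lambda>i. pdiff i ^^ Poly_Mapping.lookup a i)
     (sorted_list_of_set (Poly_Mapping.keys a))"

definition act :: "mpoly \<Rightarrow> mpoly \<Rightarrow> mpoly" where
  "act \<alpha> f = (\<Sum>a\<in>Poly_Mapping.keys \<alpha>. Const (Poly_Mapping.lookup \<alpha> a) * monom_act a f)"

text \<open>The rings \<open>Q\<close> and \<open>R\<close> are both \<open>mpoly_ring (Suc n)\<close>.\<close>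

definition Ann :: "nat \<Rightarrow> mpoly \<Rightarrow> mpoly set" where
  "Ann n f = {\<alpha> \<in> mpolys (Suc n). act \<alpha> f = 0}"

definition A_ring :: "nat \<Rightarrow> mpoly \<Rightarrow> mpoly set ring" where
  "A_ring n f = mpoly_ring (Suc n) Quot Ann n f"

definition A_class :: "nat \<Rightarrow> mpoly \<Rightarrow> mpoly \<Rightarrow> mpoly set" where
  "A_class n f \<alpha> = Ann n f +>\<^bsub>mpoly_ring (Suc n)\<^esub> \<alpha>"

definition A_deg :: "nat \<Rightarrow> mpoly \<Rightarrow> nat \<Rightarrow> mpoly set set" where
  "A_deg n f j = A_class n f ` {\<alpha> \<in> mpolys (Suc n). homogeneous j \<alpha>}"

definition A_scalars :: "nat \<Rightarrow> mpoly \<Rightarrow> mpoly set set" where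
  "A_scalars n f = range (\<lambda>c. A_class n f (Const c))"

text \<open>All representatives of an element of \<open>A(f)\<close> act on \<open>f\<close> in the same way.\<close>

definition A_act :: "mpoly set \<Rightarrow> mpoly \<Rightarrow> mpoly" where
  "A_act a f = the_elem ((\<lambda>\<alpha>. act \<alpha> f) ` a)"

definition A_deg_basis :: "nat \<Rightarrow> mpoly \<Rightarrow> nat \<Rightarrow> mpoly set list \<Rightarrow> bool" where
  "A_deg_basis n f j bs \<longleftrightarrow>
     set bs \<subseteq> A_deg n f j \<and>
     ring.independent (A_ring n f) (A_scalars n f) bs \<and>
     ring.Span (A_ring n f) (A_scalars n f) bs = A_deg n f j"

text \<open>For \<open>k \<ge> 1\<close>: multiplication by some \<open>L \<in> A\<^sub>1\<close> is injective from \<open>A\<^bsub>k-1\<^esub>\<close> to \<open>A\<^sub>k\<close>.\<close>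

definition injective_mult_into :: "nat \<Rightarrow> mpoly \<Rightarrow> nat \<Rightarrow> bool" where
  "injective_mult_into n f k \<longleftrightarrow>
     (\<exists>L\<in>A_deg n f 1. inj_on (\<lambda>a. L \<otimes>\<^bsub>A_ring n f\<^esub> a) (A_deg n f (k - 1)))"

definition Hess_mat :: "nat \<Rightarrow> mpoly \<Rightarrow> mpoly set list \<Rightarrow> mpoly mat" where
  "Hess_mat n f bs = mat (length bs) (length bs)
     (\<lambda>(i, l). A_act (bs ! i \<otimes>\<^bsub>A_ring n f\<^esub> bs ! l) f)"

definition hess :: "nat \<Rightarrow> mpoly \<Rightarrow> mpoly set list \<Rightarrow> mpoly" where
  "hess n f bs = det (Hess_mat n f bs)"

section \<open>Projective space and its Zariski topology\<close>

text \<open>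
  Here \<open>m\<close> counts homogeneous coordinates: \<open>proj m\<close> is the projective space of dimension
  \<open>m - 1\<close>. A point is the set of all its homogeneous coordinate vectors.
\<close>

definition hcoords :: "nat \<Rightarrow> (nat \<Rightarrow> complex) set" where
  "hcoords m = {v. v \<noteq> (\<lambda>_. 0) \<and> (\<forall>i\<ge>m. v i = 0)}"

definition proj_pt :: "(nat \<Rightarrow> complex) \<Rightarrow> (nat \<Rightarrow> complex) set" where
  "proj_pt v = {\<lambda>i. c * v i | c. c \<noteq> 0}"

definition proj :: "nat \<Rightarrow> (nat \<Rightarrow> complex) set set" where
  "proj m = proj_pt ` hcoords m"

definition zero_locus :: "nat \<Rightarrow> mpoly set \<Rightarrow> (nat \<Rightarrow> complex) set set" where
  "zero_locus m S = {P \<in> proj m. \<forall>g\<in>S. \<forall>v\<in>P. peval v g = 0}"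

definition zariski_open :: "nat \<Rightarrow> (nat \<Rightarrow> complex) set set \<Rightarrow> bool" where
  "zariski_open m U \<longleftrightarrow>
     (\<exists>S. (\<forall>g\<in>S. g \<in> mpolys m \<and> (\<exists>e. homogeneous e g)) \<and> U = proj m - zero_locus m S)"

definition zariski :: "nat \<Rightarrow> (nat \<Rightarrow> complex) set topology" where
  "zariski m = topology (zariski_open m)"

lemma peval_superset:
  assumes "finite K" "Poly_Mapping.keys p \<subseteq> K"
  shows "peval v p = (\<Sum>a\<in>K.
     Poly_Mapping.lookup p a * (\<Prod>i\<in>Poly_Mapping.keys a. v i ^ Poly_Mapping.lookup a i))"
  unfolding peval_def using assms
  by (intro sum.mono_neutral_left) (auto simp: in_keys_iff)

lemma peval_zero [simp]: "peval v 0 = 0"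
  by (simp add: peval_def)

lemma peval_add: "peval v (p + q) = peval v p + peval v q"
proof -
  let ?K = "Poly_Mapping.keys p \<union> Poly_Mapping.keys q"
  have "Poly_Mapping.keys (p + q) \<subseteq> ?K"
    by (rule keys_add)
  then show ?thesis
    by (simp add: peval_superset[of ?K] lookup_add distrib_right sum.distrib)
qed

lemma peval_sum: "peval v (\<Sum>x\<in>X. p x) = (\<Sum>x\<in>X. peval v (p x))"
  by (induction X rule: infinite_finite_induct) (auto simp: peval_add)

lemma peval_single:
  "peval v (Poly_Mapping.single a c) = c * (\<Prod>i\<in>Poly_Mapping.keys a. v i ^ Poly_Mapping.lookup a i)"
  by (simp add: peval_def)

lemma mpoly_eq_sum_single:
  "(p :: mpoly) = (\<Sum>a\<in>Poly_Mapping.keys p. Poly_Mapping.single a (Poly_Mapping.lookup p a))"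
  by (rule poly_mapping_eqI)
    (auto simp: lookup_sum lookup_single when_def in_keys_iff sum.delta)

lemma prod_power_superset:
  fixes v :: "nat \<Rightarrow> complex"
  assumes "finite K" "Poly_Mapping.keys a \<subseteq> K"
  shows "(\<Prod>i\<in>Poly_Mapping.keys a. v i ^ Poly_Mapping.lookup a i) =
    (\<Prod>i\<in>K. v i ^ Poly_Mapping.lookup a i)"
  using assms by (intro prod.mono_neutral_left) (auto simp: in_keys_iff)

lemma peval_mult: "peval v (p * q) = peval v p * peval v q"
proof -
  let ?M = "\<lambda>a. \<Prod>i\<in>Poly_Mapping.keys a. v i ^ Poly_Mapping.lookup a i"
  have M: "?M (a + b) = ?M a * ?M b" for a b :: "nat \<Rightarrow>\<^sub>0 nat"
  proof -
    let ?K = "Poly_Mapping.keys a \<union> Poly_Mapping.keys b"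
    have "?M (a + b) = (\<Prod>i\<in>?K. v i ^ Poly_Mapping.lookup (a + b) i)"
      by (rule prod_power_superset) (auto simp: keys_add)
    also have "\<dots> = ?M a * ?M b"
      by (simp add: prod_power_superset[of ?K a] prod_power_superset[of ?K b]
          lookup_add power_add prod.distrib)
    finally show ?thesis .
  qed
  have "p * q = (\<Sum>a\<in>Poly_Mapping.keys p. \<Sum>b\<in>Poly_Mapping.keys q.
      Poly_Mapping.single (a + b) (Poly_Mapping.lookup p a * Poly_Mapping.lookup q b))"
    by (subst mpoly_eq_sum_single[of p], subst mpoly_eq_sum_single[of q])
      (simp only: sum_product mult_single)
  then have "peval v (p * q) = (\<Sum>a\<in>Poly_Mapping.keys p. \<Sum>b\<in>Poly_Mapping.keys q.
      (Poly_Mapping.lookup p a * ?M a) * (Poly_Mapping.lookup q b * ?M b))"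
    by (simp add: peval_sum peval_single M mult_ac)
  then show ?thesis
    by (simp only: peval_def sum_product)
qed

lemma peval_scale:
  assumes "homogeneous e p"
  shows "peval (\<lambda>i. c * v i) p = c ^ e * peval v p"
  using assms unfolding peval_def homogeneous_def sum_distrib_left
  by (intro sum.cong) (auto simp: power_mult_distrib prod.distrib simp flip: power_sum)

lemma homogeneous_mult:
  assumes "homogeneous d p" "homogeneous e q"
  shows "homogeneous (d + e) (p * q)"
  unfolding homogeneous_def
proof
  fix c assume "c \<in> Poly_Mapping.keys (p * q)"
  then obtain a b where ab: "a \<in> Poly_Mapping.keys p" "b \<in> Poly_Mapping.keys q" "c = a + b"
    using keys_mult[of p q] by auto
  have deg: "(\<Sum>i\<in>Poly_Mapping.keys a'. Poly_Mapping.lookup a' i) =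
      (\<Sum>i\<in>Poly_Mapping.keys a \<union> Poly_Mapping.keys b. Poly_Mapping.lookup a' i)"
    if "Poly_Mapping.keys a' \<subseteq> Poly_Mapping.keys a \<union> Poly_Mapping.keys b" for a' :: "nat \<Rightarrow>\<^sub>0 nat"
    using that by (intro sum.mono_neutral_left) (auto simp: in_keys_iff)
  have "(\<Sum>i\<in>Poly_Mapping.keys c. Poly_Mapping.lookup c i) =
      (\<Sum>i\<in>Poly_Mapping.keys a \<union> Poly_Mapping.keys b. Poly_Mapping.lookup c i)"
    using keys_add[of a b] ab(3) by (intro deg) auto
  also have "\<dots> = (\<Sum>i\<in>Poly_Mapping.keys a. Poly_Mapping.lookup a i) +
      (\<Sum>i\<in>Poly_Mapping.keys b. Poly_Mapping.lookup b i)"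
    by (simp add: deg[of a] deg[of b] ab(3) lookup_add sum.distrib)
  finally show "(\<Sum>i\<in>Poly_Mapping.keys c. Poly_Mapping.lookup c i) = d + e"
    using assms ab by (simp add: homogeneous_def)
qed

lemma mpolys_mult:
  assumes "p \<in> mpolys m" "q \<in> mpolys m"
  shows "p * q \<in> mpolys m"
proof -
  have "Poly_Mapping.keys c \<subseteq> {..<m}" if c: "c \<in> Poly_Mapping.keys (p * q)" for c
  proof -
    obtain a b where "a \<in> Poly_Mapping.keys p" "b \<in> Poly_Mapping.keys q" "c = a + b"
      using keys_mult[of p q] c by blast
    with assms keys_add[of a b] show ?thesis
      by (fastforce simp: mpolys_def pvars_def)
  qed
  then show ?thesis
    by (auto simp: mpolys_def pvars_def)
qed

lemma istopology_zariski_open: "istopology (zariski_open m)"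
  unfolding istopology_def
proof (intro conjI allI impI)
  fix U V assume "zariski_open m U" "zariski_open m V"
  then obtain S T where
    S: "\<forall>g\<in>S. g \<in> mpolys m \<and> (\<exists>e. homogeneous e g)" "U = proj m - zero_locus m S" and
    T: "\<forall>g\<in>T. g \<in> mpolys m \<and> (\<exists>e. homogeneous e g)" "V = proj m - zero_locus m T"
    unfolding zariski_open_def by blast
  let ?ST = "{g * h | g h. g \<in> S \<and> h \<in> T}"
  have nz: "peval w g \<noteq> 0" if g: "g \<in> S \<union> T" and P: "P \<in> proj m" "v \<in> P" "w \<in> P"
    and "peval v g \<noteq> 0" for P v w g
  proof -
    obtain u c c' where "v = (\<lambda>i. c * u i)" "w = (\<lambda>i. c' * u i)" "c \<noteq> 0" "c' \<noteq> 0"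
      using P by (auto simp: proj_def proj_pt_def)
    moreover obtain e where "homogeneous e g"
      using g S T by blast
    ultimately show ?thesis
      using that by (auto simp: peval_scale)
  qed
  have "U \<inter> V = proj m - zero_locus m ?ST"
  proof (intro subset_antisym subsetI)
    fix P assume P: "P \<in> U \<inter> V"
    then obtain g h v w where gh: "g \<in> S" "h \<in> T" "v \<in> P" "w \<in> P" "peval v g \<noteq> 0" "peval w h \<noteq> 0"
      and "P \<in> proj m"
      using S T by (auto simp: zero_locus_def)
    moreover have "peval v h \<noteq> 0"
      using nz[of h P w v] gh \<open>P \<in> proj m\<close> by auto
    ultimately have "peval v (g * h) \<noteq> 0"
      by (simp add: peval_mult)
    moreover have "g * h \<in> ?ST"
      using gh by blast
    ultimately have "P \<notin> zero_locus m ?ST"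
      using \<open>v \<in> P\<close> unfolding zero_locus_def by blast
    then show "P \<in> proj m - zero_locus m ?ST"
      using \<open>P \<in> proj m\<close> by blast
  next
    fix P assume "P \<in> proj m - zero_locus m ?ST"
    then obtain g h v where "g \<in> S" "h \<in> T" "v \<in> P" "peval v (g * h) \<noteq> 0" "P \<in> proj m"
      by (auto simp: zero_locus_def)
    then show "P \<in> U \<inter> V"
      using S T by (auto simp: zero_locus_def peval_mult)
  qed
  moreover have "\<forall>g\<in>?ST. g \<in> mpolys m \<and> (\<exists>e. homogeneous e g)"
    using S T by (blast intro: mpolys_mult homogeneous_mult)
  ultimately show "zariski_open m (U \<inter> V)"
    unfolding zariski_open_def by blast
next
  fix \<K> assume "\<forall>K\<in>\<K>. zariski_open m K"
  then obtain S where S: "\<And>K. K \<in> \<K> \<Longrightarrow>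
      (\<forall>g\<in>S K. g \<in> mpolys m \<and> (\<exists>e. homogeneous e g)) \<and> K = proj m - zero_locus m (S K)"
    unfolding zariski_open_def by metis
  have "\<Union>\<K> = (\<Union>K\<in>\<K>. proj m - zero_locus m (S K))"
    using S by auto
  also have "\<dots> = proj m - zero_locus m (\<Union>K\<in>\<K>. S K)"
    by (auto simp: zero_locus_def)
  finally have "\<Union>\<K> = proj m - zero_locus m (\<Union>K\<in>\<K>. S K)" .
  moreover have "\<forall>g\<in>(\<Union>K\<in>\<K>. S K). g \<in> mpolys m \<and> (\<exists>e. homogeneous e g)"
    using S by blast
  ultimately show "zariski_open m (\<Union>\<K>)"
    unfolding zariski_open_def by (intro exI conjI)
qed

lemma openin_zariski: "openin (zariski m) = zariski_open m"
  by (simp add: zariski_def istopology_zariski_open)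

lemma topspace_zariski: "topspace (zariski m) = proj m"
proof -
  have "v \<in> proj_pt v" for v
    unfolding proj_pt_def by (rule CollectI, rule exI[of _ 1]) simp
  then have "zero_locus m {1} = {}"
    by (auto simp: zero_locus_def peval_def proj_def)
  then have "zariski_open m (proj m)"
    unfolding zariski_open_def
    by (intro exI[of _ "{1}"]) (auto simp: mpolys_def pvars_def homogeneous_def)
  moreover have "U \<subseteq> proj m" if "zariski_open m U" for U
    using that by (auto simp: zariski_open_def)
  ultimately show ?thesis
    unfolding topspace_def openin_zariski by blast
qed

definition irreducible_closedin :: "'a topology \<Rightarrow> 'a set \<Rightarrow> bool" where
  "irreducible_closedin X Z \<longleftrightarrow> closedin X Z \<and> Z \<noteq> {} \<and>
     (\<forall>F G. closedin X F \<and> closedin X G \<and> Z = F \<union> G \<longrightarrow> Z = F \<or> Z = G)"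

text \<open>Krull dimension; the empty space, which does not occur below, would get dimension 0.\<close>

definition krull_dim :: "'a topology \<Rightarrow> enat" where
  "krull_dim X = Sup {enat l | l. \<exists>Z :: nat \<Rightarrow> 'a set.
     (\<forall>i\<le>l. irreducible_closedin X (Z i)) \<and> (\<forall>i<l. Z i \<subset> Z (Suc i))}"

section \<open>Relative polar maps\<close>

definition polar_coords :: "mpoly \<Rightarrow> mpoly set list \<Rightarrow> (nat \<Rightarrow> complex) \<Rightarrow> nat \<Rightarrow> complex" where
  "polar_coords f bs v = (\<lambda>i. if i < length bs then peval v (A_act (bs ! i) f) else 0)"

text \<open>
  The intersection restricts the rational map to the points where the forms
  \<open>\<alpha>\<^sub>i(f)\<close> do not all vanish.
\<close>

definition polar_image :: "nat \<Rightarrow> mpoly \<Rightarrow> mpoly set list \<Rightarrow> (nat \<Rightarrow> complex) set set" where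
  "polar_image n f bs =
     proj_pt ` (polar_coords f bs ` hcoords (Suc n) \<inter> hcoords (length bs))"

definition polar_variety :: "nat \<Rightarrow> mpoly \<Rightarrow> mpoly set list \<Rightarrow> (nat \<Rightarrow> complex) set set" where
  "polar_variety n f bs = zariski (length bs) closure_of polar_image n f bs"

definition polar_degenerated :: "nat \<Rightarrow> mpoly \<Rightarrow> mpoly set list \<Rightarrow> bool" where
  "polar_degenerated n f bs \<longleftrightarrow>
     krull_dim (subtopology (zariski (length bs)) (polar_variety n f bs)) < enat n"

end

theory Submission
  imports Defs
begin

text \<open>
  Multiplication by the linear form \<open>L\<^sub>p = \<Sum>\<^sub>i p\<^sub>i X\<^sub>i\<close> ties everything together. Euler's formula says that
  \<open>L\<^sub>p\<^sup>e g = e! g(p)\<close> for a form \<open>g\<close> of degree \<open>e\<close>. Hence, up to factorials, the Hessian matrix of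
  order \<open>j\<close> at \<open>p\<close> is the matrix of \<open>L\<^sub>p\<^bsup>d-2j\<^esup>: A\<^sub>j \<rightarrow> A\<^bsub>d-j\<^esub>\<close> under the perfect pairing of \<open>A\<^sub>j\<close> with
  \<open>A\<^bsub>d-j\<^esub>\<close>, and the Jacobian matrix at \<open>p\<close> of the affine polar map \<open>p \<mapsto> (\<alpha>\<^sub>l(f)(p))\<^sub>l\<close> is the matrix of
  \<open>L\<^sub>p\<^bsup>d-j-1\<^esup>: A\<^sub>1 \<rightarrow> A\<^bsub>d-j\<^esub>\<close>. The second map factors through the first as
  \<open>L\<^sub>p\<^bsup>d-2j\<^esup> \<circ> L\<^sub>p\<^bsup>j-1\<^esup>\<close>, where \<open>L\<^sub>p\<^bsup>j-1\<^esup>: A\<^sub>1 \<rightarrow> A\<^sub>j\<close>.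

  Injectivity of \<open>L: A\<^bsub>k-1\<^esub> \<rightarrow> A\<^sub>k\<close> passes down to all lower degrees, because an element of \<open>A\<close> of degree
  less than \<open>d\<close> that is killed by all \<open>X\<^sub>i\<close> is zero (\<open>injective_mult_descends\<close>); so \<open>L\<^bsup>j-1\<^esup>\<close> is
  injective on \<open>A\<^sub>1\<close> for \<open>j \<le> k\<close>. If the Hessian determinant were not the zero polynomial, then for a
  general \<open>p\<close> both factors would be injective, and so would be their composition. Since \<open>f\<close> is not a cone,
  \<open>A\<^sub>1\<close> has dimension \<open>n + 1\<close>. So the Jacobian matrix of the polar map has rank \<open>n + 1\<close> at
  \<open>p\<close> (\<open>polar_jacobian_injective\<close>).

  It remains to see that the image closure then has Krull dimension at least \<open>n\<close>, for which a strict chain of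
  \<open>n + 1\<close> irreducible closed subsets suffices (\<open>krull_dim_ge\<close>). Such a chain is formed by the closures of the
  images of a flag of linear subspaces through \<open>p\<close>. They are irreducible because a product of nonzero polynomial
  functions is nonzero. They are distinct for the following reason. On the subspace with \<open>i + 2\<close> parameters,
  \<open>i + 2\<close> suitable linear combinations of the coordinate forms have a nonzero Jacobian determinant, so they are
  algebraically independent (\<open>jacobian_criterion\<close>); on the subspace with only \<open>i + 1\<close> parameters the same
  \<open>i + 2\<close> forms satisfy a homogeneous relation, by counting monomials
  (\<open>forms_algebraically_dependent\<close>). This relation vanishes on the smaller image but not on the larger one.
\<close>

section \<open>Differential operators on coefficients\<close>

definition mdeg :: "(nat \<Rightarrow>\<^sub>0 nat) \<Rightarrow> nat" where
  "mdeg a = (\<Sum>i\<in>Poly_Mapping.keys a. Poly_Mapping.lookup a i)"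

lemma homogeneous_iff: "homogeneous d p \<longleftrightarrow> (\<forall>a. Poly_Mapping.lookup p a \<noteq> 0 \<longrightarrow> mdeg a = d)"
  by (auto simp: homogeneous_def mdeg_def in_keys_iff)

lemma mdeg_superset:
  assumes "finite K" "Poly_Mapping.keys a \<subseteq> K"
  shows "mdeg a = (\<Sum>i\<in>K. Poly_Mapping.lookup a i)"
  unfolding mdeg_def using assms by (intro sum.mono_neutral_left) (auto simp: in_keys_iff)

lemma mdeg_add: "mdeg (a + b) = mdeg a + mdeg b"
proof -
  let ?K = "Poly_Mapping.keys a \<union> Poly_Mapping.keys b"
  have "Poly_Mapping.keys (a + b) \<subseteq> ?K" by (rule keys_add)
  then show ?thesis
    by (simp add: mdeg_superset[of ?K] lookup_add sum.distrib)
qed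

lemma mdeg_zero [simp]: "mdeg 0 = 0"
  by (simp add: mdeg_def)

lemma mdeg_single [simp]: "mdeg (Poly_Mapping.single i e) = e"
  by (simp add: mdeg_def)

lemma mdeg_eq_0_iff: "mdeg a = 0 \<longleftrightarrow> a = 0"
  by (auto simp: mdeg_def in_keys_iff intro!: poly_mapping_eqI)

lemma mpolys_iff:
  "p \<in> mpolys m \<longleftrightarrow> (\<forall>a. Poly_Mapping.lookup p a \<noteq> 0 \<longrightarrow> Poly_Mapping.keys a \<subseteq> {..<m})"
  unfolding mpolys_def pvars_def in_keys_iff[symmetric] by blast

lemma lookup_Const_mult [simp]:
  "Poly_Mapping.lookup (Const c * p) a = c * Poly_Mapping.lookup p a"
proof -
  have "Const c * p = Poly_Mapping.map ((*) c) p"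
    unfolding Const_def by (rule mult_map_scale_conv_mult[symmetric])
  then show ?thesis by (simp add: map.rep_eq when_def)
qed

lemma keys_add_nat:
  "Poly_Mapping.keys (a + b :: nat \<Rightarrow>\<^sub>0 nat) = Poly_Mapping.keys a \<union> Poly_Mapping.keys b"
  by (auto simp: in_keys_iff lookup_add)

lemma lookup_pdiff:
  "Poly_Mapping.lookup (pdiff i p) b =
     of_nat (Suc (Poly_Mapping.lookup b i)) * Poly_Mapping.lookup p (b + Poly_Mapping.single i 1)"
proof -
  let ?e = "Poly_Mapping.single i (1::nat)"
  have eq: "a - ?e = b \<longleftrightarrow> a = b + ?e" if "Poly_Mapping.lookup a i \<noteq> 0" for a
  proof
    assume ab: "a - ?e = b"
    show "a = b + ?e"
    proof (rule poly_mapping_eqI)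
      fix k
      show "Poly_Mapping.lookup a k = Poly_Mapping.lookup (b + ?e) k"
        using that arg_cong[OF ab, of "\<lambda>x. Poly_Mapping.lookup x k"]
        by (cases "k = i") (auto simp: lookup_add lookup_minus lookup_single when_def)
    qed
  next
    assume "a = b + ?e"
    then show "a - ?e = b" by simp
  qed
  have "Poly_Mapping.lookup (pdiff i p) b =
    (\<Sum>a\<in>Poly_Mapping.keys p. if a - ?e = b
       then of_nat (Poly_Mapping.lookup a i) * Poly_Mapping.lookup p a else 0)"
    by (simp add: pdiff_def lookup_sum lookup_single when_def)
  also have "\<dots> = (\<Sum>a\<in>Poly_Mapping.keys p. if a = b + ?e
       then of_nat (Poly_Mapping.lookup a i) * Poly_Mapping.lookup p a else 0)"
  proof (rule sum.cong[OF refl])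
    fix a
    show "(if a - ?e = b then of_nat (Poly_Mapping.lookup a i) * Poly_Mapping.lookup p a else 0) =
      (if a = b + ?e then of_nat (Poly_Mapping.lookup a i) * Poly_Mapping.lookup p a else 0)"
      using eq[of a] by (cases "Poly_Mapping.lookup a i = 0") auto
  qed
  also have "\<dots> = of_nat (Suc (Poly_Mapping.lookup b i)) * Poly_Mapping.lookup p (b + ?e)"
    by (auto simp: in_keys_iff lookup_add)
  finally show ?thesis .
qed

definition mfact :: "(nat \<Rightarrow>\<^sub>0 nat) \<Rightarrow> complex" where
  "mfact a = (\<Prod>i\<in>Poly_Mapping.keys a. fact (Poly_Mapping.lookup a i))"

lemma mfact_nonzero [simp]: "mfact a \<noteq> 0"
  by (simp add: mfact_def)

lemma mfact_zero [simp]: "mfact 0 = 1"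
  by (simp add: mfact_def)

lemma mfact_superset:
  assumes "finite K" "Poly_Mapping.keys a \<subseteq> K"
  shows "mfact a = (\<Prod>i\<in>K. fact (Poly_Mapping.lookup a i))"
  unfolding mfact_def using assms by (intro prod.mono_neutral_left) (auto simp: in_keys_iff)

lemma mfact_add_single:
  "mfact (b + Poly_Mapping.single i 1) = of_nat (Suc (Poly_Mapping.lookup b i)) * mfact b"
proof -
  let ?K = "insert i (Poly_Mapping.keys b)"
  have 1: "mfact (b + Poly_Mapping.single i 1) =
      (\<Prod>k\<in>?K. fact (Poly_Mapping.lookup (b + Poly_Mapping.single i 1) k))"
    by (rule mfact_superset) (auto simp: keys_add_nat)
  have 2: "mfact b = (\<Prod>k\<in>?K. fact (Poly_Mapping.lookup b k))"
    by (rule mfact_superset) auto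
  have "(\<Prod>k\<in>?K - {i}. fact (Poly_Mapping.lookup (b + Poly_Mapping.single i 1) k)) =
      (\<Prod>k\<in>?K - {i}. fact (Poly_Mapping.lookup b k) :: complex)"
    by (rule prod.cong) (auto simp: lookup_add lookup_single when_def)
  then show ?thesis unfolding 1 2
    by (simp add: prod.remove[of ?K i] lookup_add algebra_simps)
qed

text \<open>The divided-power coefficients \<open>a! p\<^sub>a\<close>. In these coordinates a differential monomial \<open>X\<^sup>b\<close> merely shifts
  the index by \<open>b\<close>, so that composition of operators becomes addition of exponents.\<close>

definition dcoeff :: "mpoly \<Rightarrow> (nat \<Rightarrow>\<^sub>0 nat) \<Rightarrow> complex" where
  "dcoeff p a = mfact a * Poly_Mapping.lookup p a"

lemma mpoly_eqI_dcoeff: "(\<And>a. dcoeff p a = dcoeff q a) \<Longrightarrow> p = q"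
  by (rule poly_mapping_eqI) (simp add: dcoeff_def)

lemma dcoeff_zero [simp]: "dcoeff 0 a = 0"
  by (simp add: dcoeff_def)

lemma dcoeff_add: "dcoeff (p + q) a = dcoeff p a + dcoeff q a"
  by (simp add: dcoeff_def lookup_add algebra_simps)

lemma dcoeff_sum: "dcoeff (\<Sum>x\<in>X. p x) a = (\<Sum>x\<in>X. dcoeff (p x) a)"
  by (simp add: dcoeff_def lookup_sum sum_distrib_left)

lemma dcoeff_Const_mult: "dcoeff (Const c * p) a = c * dcoeff p a"
  by (simp add: dcoeff_def)

lemma dcoeff_pdiff: "dcoeff (pdiff i p) b = dcoeff p (Poly_Mapping.single i 1 + b)"
  unfolding dcoeff_def lookup_pdiff add.commute[of "Poly_Mapping.single i 1"] mfact_add_single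
  by (simp only: mult_ac)

lemma dcoeff_pdiff_power:
  "dcoeff ((pdiff i ^^ k) p) b = dcoeff p (Poly_Mapping.single i k + b)"
proof (induction k arbitrary: b)
  case (Suc k)
  have "Poly_Mapping.single i k + (Poly_Mapping.single i 1 + b) = Poly_Mapping.single i (Suc k) + b"
    by (simp flip: add.assoc single_add)
  then show ?case by (simp add: dcoeff_pdiff Suc)
qed simp

lemma dcoeff_monom_act: "dcoeff (monom_act a p) b = dcoeff p (a + b)"
proof -
  have fold: "dcoeff (fold (\<lambda>i. pdiff i ^^ Poly_Mapping.lookup a i) xs p) b =
      dcoeff p ((\<Sum>i\<leftarrow>xs. Poly_Mapping.single i (Poly_Mapping.lookup a i)) + b)" for xs
    by (induction xs arbitrary: p b) (simp_all add: dcoeff_pdiff_power add.assoc)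
  have "(\<Sum>i\<leftarrow>sorted_list_of_set (Poly_Mapping.keys a). Poly_Mapping.single i (Poly_Mapping.lookup a i)) =
      (\<Sum>i\<in>Poly_Mapping.keys a. Poly_Mapping.single i (Poly_Mapping.lookup a i))"
    by (subst sum_list_distinct_conv_sum_set) simp_all
  also have "\<dots> = a"
    by (rule poly_mapping_eqI)
      (auto simp: lookup_sum lookup_single when_def in_keys_iff sum.delta)
  finally show ?thesis by (simp add: monom_act_def fold)
qed

lemma dcoeff_act:
  "dcoeff (act \<alpha> f) b = (\<Sum>a\<in>Poly_Mapping.keys \<alpha>. Poly_Mapping.lookup \<alpha> a * dcoeff f (a + b))"
  by (simp add: act_def dcoeff_sum dcoeff_Const_mult dcoeff_monom_act)

lemma dcoeff_act_superset:
  assumes "finite K" "Poly_Mapping.keys \<alpha> \<subseteq> K"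
  shows "dcoeff (act \<alpha> f) b = (\<Sum>a\<in>K. Poly_Mapping.lookup \<alpha> a * dcoeff f (a + b))"
  unfolding dcoeff_act using assms by (intro sum.mono_neutral_left) (auto simp: in_keys_iff)

lemma act_add: "act (\<alpha> + \<beta>) f = act \<alpha> f + act \<beta> f"
proof (rule mpoly_eqI_dcoeff)
  fix b
  let ?K = "Poly_Mapping.keys \<alpha> \<union> Poly_Mapping.keys \<beta>"
  show "dcoeff (act (\<alpha> + \<beta>) f) b = dcoeff (act \<alpha> f + act \<beta> f) b"
    using keys_add[of \<alpha> \<beta>]
    by (simp add: dcoeff_act_superset[of ?K] dcoeff_add lookup_add sum.distrib algebra_simps)
qed

lemma act_0 [simp]: "act 0 f = 0"
  by (simp add: act_def)

lemma act_zero_right [simp]: "act \<alpha> 0 = 0"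
  by (rule mpoly_eqI_dcoeff) (simp add: dcoeff_act)

lemma act_sum: "act (\<Sum>x\<in>X. \<alpha> x) f = (\<Sum>x\<in>X. act (\<alpha> x) f)"
  by (induction X rule: infinite_finite_induct) (auto simp: act_add)

lemma act_add_right: "act \<alpha> (f + g) = act \<alpha> f + act \<alpha> g"
  by (rule mpoly_eqI_dcoeff) (simp add: dcoeff_act dcoeff_add sum.distrib algebra_simps)

lemma act_sum_right: "act \<alpha> (\<Sum>x\<in>X. g x) = (\<Sum>x\<in>X. act \<alpha> (g x))"
  by (induction X rule: infinite_finite_induct) (auto simp: act_add_right)

lemma dcoeff_act_single:
  "dcoeff (act (Poly_Mapping.single a c) f) b = c * dcoeff f (a + b)"
  by (subst dcoeff_act_superset[of "{a}"]) auto

text \<open>\<open>R\<close> is a module over \<open>Q\<close>: on divided-power coefficients both sides are the double sum over pairs of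
  exponents \<open>a\<close> of \<open>\<alpha>\<close> and \<open>b\<close> of \<open>\<beta>\<close>, with the index shifted by \<open>a + b\<close>.\<close>

lemma act_mult: "act (\<alpha> * \<beta>) f = act \<alpha> (act \<beta> f)"
proof (rule mpoly_eqI_dcoeff)
  fix c
  have "\<alpha> * \<beta> = (\<Sum>a\<in>Poly_Mapping.keys \<alpha>. \<Sum>b\<in>Poly_Mapping.keys \<beta>.
      Poly_Mapping.single (a + b) (Poly_Mapping.lookup \<alpha> a * Poly_Mapping.lookup \<beta> b))"
    by (subst mpoly_eq_sum_single[of \<alpha>], subst mpoly_eq_sum_single[of \<beta>])
      (simp only: sum_product mult_single)
  then show "dcoeff (act (\<alpha> * \<beta>) f) c = dcoeff (act \<alpha> (act \<beta> f)) c"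
    by (simp add: act_sum dcoeff_sum dcoeff_act_single)
      (simp add: dcoeff_act sum_distrib_left ac_simps)
qed

lemma act_commute: "act \<alpha> (act \<beta> f) = act \<beta> (act \<alpha> f)"
  by (metis act_mult mult.commute)

lemma act_Const [simp]: "act (Const c) f = Const c * f"
proof (rule mpoly_eqI_dcoeff)
  fix b
  have "dcoeff (act (Const c) f) b = c * dcoeff f b"
    unfolding Const_def by (simp add: dcoeff_act_single)
  then show "dcoeff (act (Const c) f) b = dcoeff (Const c * f) b"
    by (simp add: dcoeff_Const_mult)
qed

lemma act_Var: "act (Var i) f = pdiff i f"
  by (rule mpoly_eqI_dcoeff) (simp add: Var_def dcoeff_act_single dcoeff_pdiff)

lemma act_Const_mult_right: "act \<alpha> (Const c * f) = Const c * act \<alpha> f"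
  by (metis act_Const act_commute)

lemma act_minus: "act (\<alpha> - \<beta>) f = act \<alpha> f - act \<beta> f"
  using act_add[of "\<alpha> - \<beta>" \<beta> f] by simp

lemma act_nonzero_coeffE:
  assumes "Poly_Mapping.lookup (act \<alpha> f) b \<noteq> 0"
  obtains a where "Poly_Mapping.lookup \<alpha> a \<noteq> 0" "Poly_Mapping.lookup f (a + b) \<noteq> 0"
proof -
  have "dcoeff (act \<alpha> f) b \<noteq> 0" using assms by (simp add: dcoeff_def)
  then have "\<exists>a\<in>Poly_Mapping.keys \<alpha>. Poly_Mapping.lookup \<alpha> a * dcoeff f (a + b) \<noteq> 0"
    unfolding dcoeff_act by (meson sum.neutral)
  then show ?thesis using that by (auto simp: dcoeff_def)
qed

lemma act_in_mpolys: "f \<in> mpolys m \<Longrightarrow> act \<alpha> f \<in> mpolys m"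
  unfolding mpolys_iff by (metis act_nonzero_coeffE keys_add_nat Un_subset_iff)

lemma homogeneous_act:
  assumes "homogeneous i \<alpha>" "homogeneous d f"
  shows "homogeneous (d - i) (act \<alpha> f)"
  unfolding homogeneous_iff
proof (intro allI impI)
  fix b assume "Poly_Mapping.lookup (act \<alpha> f) b \<noteq> 0"
  then obtain a where "Poly_Mapping.lookup \<alpha> a \<noteq> 0" "Poly_Mapping.lookup f (a + b) \<noteq> 0"
    by (rule act_nonzero_coeffE)
  then have "mdeg a = i" "mdeg (a + b) = d" using assms by (auto simp: homogeneous_iff)
  then show "mdeg b = d - i" by (simp add: mdeg_add)
qed

lemma exponent_split:
  assumes "Poly_Mapping.lookup a i \<noteq> (0::nat)"
  shows "a = Poly_Mapping.single i 1 + (a - Poly_Mapping.single i 1)"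
  using assms by (intro poly_mapping_eqI) (auto simp: lookup_add lookup_minus lookup_single when_def)

text \<open>Every exponent \<open>a\<close> of a form of positive degree contains some variable \<open>i\<close>, and in characteristic zero the
  coefficient of \<open>a\<close> survives in the derivative by that variable.\<close>

lemma homogeneous_pdiff_eq_0:
  assumes "homogeneous e g" "e > 0" "g \<in> mpolys m" "\<And>i. i < m \<Longrightarrow> pdiff i g = 0"
  shows "g = 0"
proof (rule ccontr)
  assume "g \<noteq> 0"
  then obtain a where a: "Poly_Mapping.lookup g a \<noteq> 0"
    by (metis lookup_zero poly_mapping_eqI)
  with assms have "mdeg a \<noteq> 0" by (auto simp: homogeneous_iff)
  then obtain i where i: "Poly_Mapping.lookup a i \<noteq> 0"
    by (auto simp: mdeg_def in_keys_iff)
  then have "i \<in> Poly_Mapping.keys a" by (simp add: in_keys_iff)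
  then have "i < m" using a assms(3) unfolding mpolys_iff by blast
  let ?b = "a - Poly_Mapping.single i 1"
  have "Poly_Mapping.single i 1 + ?b = a" by (rule exponent_split[OF i, symmetric])
  then have "dcoeff (pdiff i g) ?b \<noteq> 0" using a by (simp only: dcoeff_pdiff) (simp add: dcoeff_def)
  then show False using assms(4)[OF \<open>i < m\<close>] by simp
qed

section \<open>Evaluation and the chain rule\<close>

lemma peval_one [simp]: "peval v 1 = 1"
  by (simp add: peval_def)

lemma peval_Const [simp]: "peval v (Const c) = c"
  by (simp add: Const_def peval_single)

lemma peval_Var [simp]: "peval v (Var i) = v i"
  by (simp add: Var_def peval_single)

lemma peval_power: "peval v (p ^ e) = peval v p ^ e"
  by (induction e) (simp_all add: peval_mult)

lemma peval_prod: "peval v (\<Prod>x\<in>X. p x) = (\<Prod>x\<in>X. peval v (p x))"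
  by (induction X rule: infinite_finite_induct) (auto simp: peval_mult)

lemma peval_at_0: "peval (\<lambda>_. 0) p = Poly_Mapping.lookup p 0"
proof -
  have "peval (\<lambda>_. 0) p = (\<Sum>a\<in>Poly_Mapping.keys p. if a = 0 then Poly_Mapping.lookup p a else 0)"
    unfolding peval_def
  proof (rule sum.cong[OF refl])
    fix a :: "nat \<Rightarrow>\<^sub>0 nat"
    have "(\<Prod>i\<in>Poly_Mapping.keys a. (0::complex) ^ Poly_Mapping.lookup a i) = (if a = 0 then 1 else 0)"
    proof (cases "a = 0")
      case False
      then obtain i where "i \<in> Poly_Mapping.keys a"
        by (metis in_keys_iff lookup_zero poly_mapping_eqI)
      then show ?thesis using False by (auto simp: in_keys_iff)
    qed simp
    then show "Poly_Mapping.lookup p a * (\<Prod>i\<in>Poly_Mapping.keys a. 0 ^ Poly_Mapping.lookup a i) =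
      (if a = 0 then Poly_Mapping.lookup p a else 0)" by simp
  qed
  also have "\<dots> = Poly_Mapping.lookup p 0"
    by (simp add: in_keys_iff)
  finally show ?thesis .
qed

lemma peval_mpolys:
  assumes "p \<in> mpolys m"
  shows "peval v p = (\<Sum>a\<in>Poly_Mapping.keys p. Poly_Mapping.lookup p a *
    (\<Prod>i<m. v i ^ Poly_Mapping.lookup a i))"
  unfolding peval_def
proof (rule sum.cong[OF refl])
  fix a assume "a \<in> Poly_Mapping.keys p"
  then have "Poly_Mapping.keys a \<subseteq> {..<m}" using assms by (auto simp: mpolys_iff in_keys_iff)
  then show "Poly_Mapping.lookup p a * (\<Prod>i\<in>Poly_Mapping.keys a. v i ^ Poly_Mapping.lookup a i) =
      Poly_Mapping.lookup p a * (\<Prod>i<m. v i ^ Poly_Mapping.lookup a i)"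
    by (subst prod_power_superset) auto
qed

lemma peval_cong:
  assumes "p \<in> mpolys m" "\<And>i. i < m \<Longrightarrow> v i = w i"
  shows "peval v p = peval w p"
  unfolding peval_mpolys[OF assms(1)] using assms(2)
  by (intro sum.cong refl arg_cong2[where f = "(*)"] prod.cong) auto

lemma peval_pdiff:
  assumes "p \<in> mpolys m" "r < m"
  shows "peval v (pdiff r p) = (\<Sum>a\<in>Poly_Mapping.keys p. Poly_Mapping.lookup p a *
    (of_nat (Poly_Mapping.lookup a r) * v r ^ (Poly_Mapping.lookup a r - 1) *
      (\<Prod>i\<in>{..<m} - {r}. v i ^ Poly_Mapping.lookup a i)))"
  unfolding pdiff_def peval_sum
proof (rule sum.cong[OF refl])
  fix a assume "a \<in> Poly_Mapping.keys p"
  then have a: "Poly_Mapping.keys a \<subseteq> {..<m}" using assms by (auto simp: mpolys_iff in_keys_iff)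
  let ?b = "a - Poly_Mapping.single r 1"
  have "Poly_Mapping.keys ?b \<subseteq> {..<m}"
  proof
    fix i assume "i \<in> Poly_Mapping.keys ?b"
    then have "i \<in> Poly_Mapping.keys a" by (simp add: in_keys_iff lookup_minus)
    then show "i \<in> {..<m}" using a by blast
  qed
  then have "(\<Prod>i\<in>Poly_Mapping.keys ?b. v i ^ Poly_Mapping.lookup ?b i) =
      (\<Prod>i<m. v i ^ Poly_Mapping.lookup ?b i)"
    by (subst prod_power_superset[of "{..<m}"]) auto
  also have "\<dots> = v r ^ Poly_Mapping.lookup ?b r * (\<Prod>i\<in>{..<m} - {r}. v i ^ Poly_Mapping.lookup ?b i)"
    using assms(2) by (subst prod.remove[of _ r]) auto
  also have "(\<Prod>i\<in>{..<m} - {r}. v i ^ Poly_Mapping.lookup ?b i) =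
      (\<Prod>i\<in>{..<m} - {r}. v i ^ Poly_Mapping.lookup a i)"
    by (rule prod.cong) (auto simp: lookup_minus lookup_single when_def)
  finally show "peval v (Poly_Mapping.single ?b (of_nat (Poly_Mapping.lookup a r) * Poly_Mapping.lookup p a)) =
    Poly_Mapping.lookup p a * (of_nat (Poly_Mapping.lookup a r) * v r ^ (Poly_Mapping.lookup a r - 1) *
      (\<Prod>i\<in>{..<m} - {r}. v i ^ Poly_Mapping.lookup a i))"
    by (simp add: peval_single lookup_minus)
qed

text \<open>Directional derivatives, Euler's formula, the behaviour under linear substitution and the Jacobian criterion are
  all read off from this rule for complex derivatives, which spares a product rule for \<^const>\<open>pdiff\<close> on polynomials.\<close>

lemma peval_chain_rule:
  fixes \<gamma> :: "complex \<Rightarrow> nat \<Rightarrow> complex"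
  assumes p: "p \<in> mpolys m"
    and \<gamma>: "\<And>r. r < m \<Longrightarrow> ((\<lambda>t. \<gamma> t r) has_field_derivative \<gamma>' r) (at t)"
  shows "((\<lambda>t. peval (\<gamma> t) p) has_field_derivative
    (\<Sum>r<m. peval (\<gamma> t) (pdiff r p) * \<gamma>' r)) (at t)"
proof -
  let ?l = "Poly_Mapping.lookup"
  have D: "((\<lambda>t. \<Prod>i<m. \<gamma> t i ^ ?l a i) has_field_derivative
      (\<Sum>r<m. (of_nat (?l a r) * (\<gamma>' r * \<gamma> t r ^ (?l a r - 1))) *
        (\<Prod>i\<in>{..<m} - {r}. \<gamma> t i ^ ?l a i))) (at t)" for a
    by (rule has_field_derivative_prod) (use DERIV_power[OF \<gamma>] in simp)
  have "((\<lambda>t. \<Sum>a\<in>Poly_Mapping.keys p. ?l p a * (\<Prod>i<m. \<gamma> t i ^ ?l a i)) has_field_derivative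
      (\<Sum>a\<in>Poly_Mapping.keys p. ?l p a * (\<Sum>r<m. (of_nat (?l a r) * (\<gamma>' r * \<gamma> t r ^ (?l a r - 1))) *
        (\<Prod>i\<in>{..<m} - {r}. \<gamma> t i ^ ?l a i)))) (at t)"
    by (intro DERIV_sum DERIV_cmult D)
  also have "(\<lambda>t. \<Sum>a\<in>Poly_Mapping.keys p. ?l p a * (\<Prod>i<m. \<gamma> t i ^ ?l a i)) =
      (\<lambda>t. peval (\<gamma> t) p)"
    by (simp add: peval_mpolys[OF p])
  also have "(\<Sum>a\<in>Poly_Mapping.keys p. ?l p a * (\<Sum>r<m. (of_nat (?l a r) * (\<gamma>' r * \<gamma> t r ^ (?l a r - 1))) *
        (\<Prod>i\<in>{..<m} - {r}. \<gamma> t i ^ ?l a i))) = (\<Sum>r<m. peval (\<gamma> t) (pdiff r p) * \<gamma>' r)"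
    unfolding sum_distrib_left
    by (subst sum.swap, intro sum.cong refl)
      (simp add: peval_pdiff[OF p] sum_distrib_right sum_distrib_left mult_ac)
  finally show ?thesis .
qed

lemma mpolys_mono: "p \<in> mpolys m \<Longrightarrow> m \<le> k \<Longrightarrow> p \<in> mpolys k"
  by (fastforce simp: mpolys_def)

lemma mpolys_exists: "\<exists>m. p \<in> mpolys m"
proof -
  have "finite (pvars p)" by (simp add: pvars_def)
  then obtain m where "\<forall>i\<in>pvars p. i < m" by (metis finite_nat_set_iff_bounded)
  then show ?thesis by (auto simp: mpolys_def)
qed

lemma mpolys_add: "p \<in> mpolys m \<Longrightarrow> q \<in> mpolys m \<Longrightarrow> p + q \<in> mpolys m"
  unfolding mpolys_iff by (metis add.right_neutral lookup_add)

lemma mpolys_0 [simp]: "0 \<in> mpolys m" and mpolys_1 [simp]: "1 \<in> mpolys m"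
  and mpolys_Const [simp]: "Const c \<in> mpolys m"
  by (auto simp: mpolys_iff lookup_one when_def Const_def lookup_single split: if_splits)

lemma mpolys_Var: "i < m \<Longrightarrow> Var i \<in> mpolys m"
  by (auto simp: mpolys_iff Var_def lookup_single when_def split: if_splits)

lemma mpolys_sum: "(\<And>x. x \<in> X \<Longrightarrow> p x \<in> mpolys m) \<Longrightarrow> (\<Sum>x\<in>X. p x) \<in> mpolys m"
  by (induction X rule: infinite_finite_induct) (auto intro: mpolys_add)

lemma mpolys_prod: "(\<And>x. x \<in> X \<Longrightarrow> p x \<in> mpolys m) \<Longrightarrow> (\<Prod>x\<in>X. p x) \<in> mpolys m"
  by (induction X rule: infinite_finite_induct) (auto intro: mpolys_mult)

lemma mpolys_power: "p \<in> mpolys m \<Longrightarrow> p ^ e \<in> mpolys m"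
  by (induction e) (auto intro: mpolys_mult)

lemma homogeneous_zero [simp]: "homogeneous e 0" and homogeneous_1 [simp]: "homogeneous 0 1"
  and homogeneous_Const [simp]: "homogeneous 0 (Const c)" and homogeneous_Var [simp]: "homogeneous 1 (Var i)"
  by (auto simp: homogeneous_iff lookup_one when_def Const_def Var_def lookup_single split: if_splits)

lemma homogeneous_add: "homogeneous e p \<Longrightarrow> homogeneous e q \<Longrightarrow> homogeneous e (p + q)"
  unfolding homogeneous_iff by (metis add.right_neutral lookup_add)

lemma homogeneous_sum: "(\<And>x. x \<in> X \<Longrightarrow> homogeneous e (p x)) \<Longrightarrow> homogeneous e (\<Sum>x\<in>X. p x)"
  by (induction X rule: infinite_finite_induct) (auto intro: homogeneous_add)

lemma homogeneous_Const_mult: "homogeneous e p \<Longrightarrow> homogeneous e (Const c * p)"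
  using homogeneous_mult[OF homogeneous_Const] by fastforce

lemma homogeneous_power: "homogeneous e p \<Longrightarrow> homogeneous (k * e) (p ^ k)"
  by (induction k) (auto intro: homogeneous_mult)

lemma homogeneous_prod:
  "(\<And>x. x \<in> X \<Longrightarrow> homogeneous (e x) (p x)) \<Longrightarrow> homogeneous (\<Sum>x\<in>X. e x) (\<Prod>x\<in>X. p x)"
  by (induction X rule: infinite_finite_induct) (auto intro: homogeneous_mult)

definition linear_form :: "nat \<Rightarrow> (nat \<Rightarrow> complex) \<Rightarrow> mpoly" where
  "linear_form m w = (\<Sum>i<m. Const (w i) * Var i)"

lemma linear_form_in_mpolys [simp]: "linear_form m w \<in> mpolys m"
  unfolding linear_form_def by (intro mpolys_sum mpolys_mult) (auto intro: mpolys_Var)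

lemma homogeneous_linear_form [simp]: "homogeneous 1 (linear_form m w)"
  unfolding linear_form_def by (intro homogeneous_sum homogeneous_Const_mult homogeneous_Var)

lemma act_linear_form: "act (linear_form m w) g = (\<Sum>i<m. Const (w i) * pdiff i g)"
  by (simp add: linear_form_def act_sum act_mult act_Var)

lemma peval_act_linear_form:
  "peval v (act (linear_form m w) g) = (\<Sum>i<m. w i * peval v (pdiff i g))"
  by (simp add: act_linear_form peval_sum peval_mult)

lemma peval_line_deriv:
  assumes "p \<in> mpolys m"
  shows "((\<lambda>t. peval (\<lambda>i. v i + t * w i) p) has_field_derivative
    peval (\<lambda>i. v i + t * w i) (act (linear_form m w) p)) (at t)"
proof -
  have "((\<lambda>t. peval (\<lambda>i. v i + t * w i) p) has_field_derivative
      (\<Sum>r<m. peval (\<lambda>i. v i + t * w i) (pdiff r p) * w r)) (at t)"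
    by (rule peval_chain_rule[OF assms]) (auto intro!: derivative_eq_intros)
  then show ?thesis by (simp add: peval_act_linear_form mult.commute)
qed

lemma peval_eq_0_imp_pdiff:
  assumes "\<And>v. peval v p = 0"
  shows "peval v (pdiff r p) = 0"
proof -
  obtain m where m: "p \<in> mpolys m" using mpolys_exists by blast
  have p: "p \<in> mpolys (m + Suc r)" by (rule mpolys_mono[OF m]) simp
  let ?w = "\<lambda>i. if i = r then 1 else (0::complex)"
  have "((\<lambda>t. 0) has_field_derivative
      peval (\<lambda>i. v i + 0 * ?w i) (act (linear_form (m + Suc r) ?w) p)) (at 0)"
    using peval_line_deriv[OF p, of v ?w 0] by (simp add: assms del: add_Suc_right)
  then have "peval v (act (linear_form (m + Suc r) ?w) p) = 0"
    using DERIV_unique[OF _ DERIV_const] by fastforce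
  then show ?thesis
    by (simp add: peval_act_linear_form if_distrib[of "\<lambda>x. x * _"] cong: if_cong del: add_Suc_right)
qed

text \<open>All partial derivatives of a vanishing polynomial function vanish as well, and the constant term of an iterated
  derivative is a divided-power coefficient of the polynomial.\<close>

lemma peval_eq_0_imp_zero:
  assumes "\<And>v. peval v p = 0"
  shows "p = 0"
proof (rule mpoly_eqI_dcoeff)
  fix a
  show "dcoeff p a = dcoeff 0 a"
    using assms
  proof (induction "mdeg a" arbitrary: a p)
    case 0
    then show ?case using peval_at_0[of p] by (simp add: mdeg_eq_0_iff dcoeff_def)
  next
    case (Suc e)
    then have "a \<noteq> 0" by (metis Zero_not_Suc mdeg_zero)
    then obtain i where i: "Poly_Mapping.lookup a i \<noteq> 0"
      by (metis lookup_zero poly_mapping_eqI)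
    let ?b = "a - Poly_Mapping.single i 1"
    have a: "a = Poly_Mapping.single i 1 + ?b" using i by (rule exponent_split)
    have "mdeg a = 1 + mdeg ?b" by (subst a) (simp only: mdeg_add mdeg_single)
    then have "dcoeff (pdiff i p) ?b = dcoeff 0 ?b"
      using Suc by (intro Suc.hyps(1)) (auto intro: peval_eq_0_imp_pdiff)
    then show ?case using a by (metis dcoeff_pdiff dcoeff_zero)
  qed
qed

text \<open>Differentiate \<open>g((1 + t) p) = (1 + t)\<^sup>e g(p)\<close> at \<open>t = 0\<close>.\<close>

lemma euler_formula:
  assumes "homogeneous e g" "g \<in> mpolys m"
  shows "peval p (act (linear_form m p) g) = of_nat e * peval p g"
proof -
  have "((\<lambda>t. peval (\<lambda>i. p i + t * p i) g) has_field_derivative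
      peval (\<lambda>i. p i + 0 * p i) (act (linear_form m p) g)) (at 0)"
    by (rule peval_line_deriv[OF assms(2)])
  moreover have "(\<lambda>t. peval (\<lambda>i. p i + t * p i) g) = (\<lambda>t. (1 + t) ^ e * peval p g)"
    using peval_scale[OF assms(1), of "1 + _" p] by (simp add: distrib_right)
  moreover have "((\<lambda>t. (1 + t) ^ e * peval p g) has_field_derivative of_nat e * peval p g) (at 0)"
    by (auto intro!: derivative_eq_intros)
  ultimately show ?thesis by (auto intro: DERIV_unique)
qed

text \<open>This turns evaluation at \<open>p\<close> into multiplication by a power of the linear form of \<open>p\<close> in \<open>A(f)\<close>; it is the
  bridge between Hessians or Jacobians at a point and maps between graded pieces of \<open>A(f)\<close>.\<close>

lemma euler_formula_power:
  assumes "homogeneous e g" "g \<in> mpolys m"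
  shows "peval p (act (linear_form m p ^ e) g) = fact e * peval p g"
  using assms
proof (induction e arbitrary: g)
  case 0
  then show ?case using act_Const[of 1 g] by (simp add: Const_def)
next
  case (Suc e)
  have "homogeneous e (act (linear_form m p) g)"
    using homogeneous_act[OF homogeneous_linear_form Suc.prems(1)] by simp
  then have "peval p (act (linear_form m p ^ e) (act (linear_form m p) g)) =
      fact e * peval p (act (linear_form m p) g)"
    using Suc.prems(2) by (intro Suc.IH act_in_mpolys)
  then show ?case using euler_formula[OF Suc.prems]
    by (simp add: act_mult[symmetric] mult.commute) 
qed

section \<open>Functions that are polynomial along lines\<close>

text \<open>Genericity and irreducibility arguments only ever need to join two points by a line. So the functions in question
  are not represented as polynomials in several variables; it suffices that their restrictions to lines are
  univariate polynomials.\<close>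

definition line_poly :: "((nat \<Rightarrow> complex) \<Rightarrow> complex) \<Rightarrow> bool" where
  "line_poly h \<longleftrightarrow> (\<forall>v w. \<exists>q. \<forall>t. h (\<lambda>i. v i + t * w i) = poly q t)"

lemma line_poly_const: "line_poly (\<lambda>_. c)"
  unfolding line_poly_def by (auto intro!: exI[of _ "[:c:]"])

lemma line_poly_coord: "line_poly (\<lambda>v. v i)"
  unfolding line_poly_def by (intro allI, rule_tac x = "[:v i, w i:]" in exI) simp

lemma line_poly_add: "line_poly g \<Longrightarrow> line_poly h \<Longrightarrow> line_poly (\<lambda>v. g v + h v)"
  unfolding line_poly_def by (metis poly_add)

lemma line_poly_mult: "line_poly g \<Longrightarrow> line_poly h \<Longrightarrow> line_poly (\<lambda>v. g v * h v)"
  unfolding line_poly_def by (metis poly_mult)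

lemma line_poly_sum: "(\<And>x. x \<in> X \<Longrightarrow> line_poly (h x)) \<Longrightarrow> line_poly (\<lambda>v. \<Sum>x\<in>X. h x v)"
  by (induction X rule: infinite_finite_induct) (auto intro: line_poly_const line_poly_add)

lemma line_poly_prod: "(\<And>x. x \<in> X \<Longrightarrow> line_poly (h x)) \<Longrightarrow> line_poly (\<lambda>v. \<Prod>x\<in>X. h x v)"
  by (induction X rule: infinite_finite_induct) (auto intro: line_poly_const line_poly_mult)

lemma line_poly_power: "line_poly h \<Longrightarrow> line_poly (\<lambda>v. h v ^ e)"
  by (induction e) (auto intro: line_poly_const line_poly_mult)

lemma line_poly_peval: "(\<And>i. line_poly (\<lambda>v. \<gamma> v i)) \<Longrightarrow> line_poly (\<lambda>v. peval (\<gamma> v) p)"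
  unfolding peval_def
  by (intro line_poly_sum line_poly_mult line_poly_const line_poly_prod line_poly_power)

lemma permutes_bound: "\<pi> permutes {0..<m} \<Longrightarrow> i < m \<Longrightarrow> \<pi> i < (m::nat)"
  using permutes_in_image[of \<pi> "{0..<m}" i] by simp

lemma line_poly_det:
  assumes "\<And>i j. i < m \<Longrightarrow> j < m \<Longrightarrow> line_poly (\<lambda>v. c v i j)"
  shows "line_poly (\<lambda>v. det (mat m m (\<lambda>(i, j). c v i j)))"
proof -
  have eq: "det (mat m m (\<lambda>(i, j). c v i j)) =
      (\<Sum>\<pi> | \<pi> permutes {0..<m}. signof \<pi> * (\<Prod>i=0..<m. c v i (\<pi> i)))" for v
    by (subst det_def'[of _ m]) (simp_all add: permutes_bound)
  show ?thesis
    unfolding eq using assms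
    by (intro line_poly_sum line_poly_mult line_poly_const line_poly_prod)
      (simp add: permutes_bound)
qed

text \<open>The substitute for the irreducibility of affine space: on the line from \<open>v\<close> to \<open>w\<close> both functions are nonzero
  univariate polynomials, so they have only finitely many zeros.\<close>

lemma line_poly_common_nonzero:
  assumes "line_poly g" "line_poly h" "g v \<noteq> 0" "h w \<noteq> 0"
  shows "\<exists>u. g u \<noteq> 0 \<and> h u \<noteq> 0"
proof -
  define \<gamma> where "\<gamma> t = (\<lambda>i. v i + t * (w i - v i))" for t :: complex
  have "\<exists>q. \<forall>t. g (\<gamma> t) = poly q t"
    using assms(1)[unfolded line_poly_def, THEN spec, THEN spec, of v "\<lambda>i. w i - v i"]
    by (simp only: \<gamma>_def)
  then obtain q where q: "\<forall>t. g (\<gamma> t) = poly q t" ..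
  have "\<exists>r. \<forall>t. h (\<gamma> t) = poly r t"
    using assms(2)[unfolded line_poly_def, THEN spec, THEN spec, of v "\<lambda>i. w i - v i"]
    by (simp only: \<gamma>_def)
  then obtain r where r: "\<forall>t. h (\<gamma> t) = poly r t" ..
  have "\<gamma> 0 = v" "\<gamma> 1 = w" by (auto simp: \<gamma>_def)
  with q[THEN spec, of 0] r[THEN spec, of 1] assms have "q \<noteq> 0" "r \<noteq> 0" by auto
  then have "q * r \<noteq> 0" by simp
  then obtain t where "poly (q * r) t \<noteq> 0" using poly_all_0_iff_0 by blast
  with q r show ?thesis by (metis mult_eq_0_iff poly_mult)
qed

section \<open>Square systems of linear equations\<close>

lemma det_mat_eq_0_iff:
  fixes c :: "nat \<Rightarrow> nat \<Rightarrow> complex"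
  shows "det (mat m m (\<lambda>(i, j). c i j)) = 0 \<longleftrightarrow>
    (\<exists>w. (\<exists>i<m. w i \<noteq> 0) \<and> (\<forall>i<m. (\<Sum>j<m. c i j * w j) = 0))"
proof -
  let ?A = "mat m m (\<lambda>(i, j). c i j)"
  have A: "?A \<in> carrier_mat m m" by simp
  have row: "(?A *\<^sub>v v) $ i = (\<Sum>j<m. c i j * v $ j)" if "i < m" "v \<in> carrier_vec m" for i v
    using that by (simp add: mult_mat_vec_def scalar_prod_def lessThan_atLeast0)
  show ?thesis unfolding det_0_iff_vec_prod_zero_field[OF A]
  proof
    assume "\<exists>v. v \<in> carrier_vec m \<and> v \<noteq> 0\<^sub>v m \<and> ?A *\<^sub>v v = 0\<^sub>v m"
    then obtain v where v: "v \<in> carrier_vec m" "v \<noteq> 0\<^sub>v m" "?A *\<^sub>v v = 0\<^sub>v m" by blast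
    have "\<exists>i<m. v $ i \<noteq> 0" using v(1,2) by (metis eq_vecI carrier_vecD index_zero_vec)
    moreover have "\<forall>i<m. (\<Sum>j<m. c i j * v $ j) = 0" using row[OF _ v(1)] v(3) by simp
    ultimately show "\<exists>w. (\<exists>i<m. w i \<noteq> 0) \<and> (\<forall>i<m. (\<Sum>j<m. c i j * w j) = 0)"
      by (intro exI[of _ "\<lambda>i. v $ i"]) simp
  next
    assume "\<exists>w. (\<exists>i<m. w i \<noteq> 0) \<and> (\<forall>i<m. (\<Sum>j<m. c i j * w j) = 0)"
    then obtain w i where w: "i < m" "w i \<noteq> 0" "\<forall>i<m. (\<Sum>j<m. c i j * w j) = 0" by blast
    have "vec m w \<noteq> 0\<^sub>v m" using w(1,2) by (metis index_vec index_zero_vec(1))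
    moreover have "?A *\<^sub>v vec m w = 0\<^sub>v m"
      using w(3) by (intro eq_vecI) (simp_all add: scalar_prod_def lessThan_atLeast0)
    ultimately show "\<exists>v. v \<in> carrier_vec m \<and> v \<noteq> 0\<^sub>v m \<and> ?A *\<^sub>v v = 0\<^sub>v m"
      by (intro exI[of _ "vec m w"]) simp
  qed
qed

lemma det_mat_swap:
  fixes c :: "nat \<Rightarrow> nat \<Rightarrow> complex"
  shows "det (mat m m (\<lambda>(i, j). c j i)) = det (mat m m (\<lambda>(i, j). c i j))"
proof -
  have "mat m m (\<lambda>(i, j). c j i) = transpose_mat (mat m m (\<lambda>(i, j). c i j))"
    by (rule eq_matI) auto
  then show ?thesis by (simp add: det_transpose[of _ m])
qed

text \<open>If a possibly rectangular matrix \<open>T\<close> has trivial kernel, then \<open>T\<^sup>* T\<close> is invertible, since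
  \<open>T\<^sup>* T w = 0\<close> gives \<open>\<parallel>T w\<parallel>\<^sup>2 = 0\<close>. This replaces the choice of a nonvanishing maximal minor: the rows of
  \<open>T\<^sup>*\<close> provide fixed linear combinations in which injectivity is detected by one determinant.\<close>

lemma gram_det_nonzero:
  fixes T :: "'a \<Rightarrow> nat \<Rightarrow> complex"
  assumes "finite K"
    and inj: "\<And>w. (\<And>x. x \<in> K \<Longrightarrow> (\<Sum>i<m. T x i * w i) = 0) \<Longrightarrow> (\<forall>i<m. w i = 0)"
  shows "det (mat m m (\<lambda>(r, i). \<Sum>x\<in>K. cnj (T x r) * T x i)) \<noteq> 0"
proof
  assume "det (mat m m (\<lambda>(r, i). \<Sum>x\<in>K. cnj (T x r) * T x i)) = 0"
  then obtain w where nz: "\<exists>i<m. w i \<noteq> 0"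
    and w: "\<forall>r<m. (\<Sum>i<m. (\<Sum>x\<in>K. cnj (T x r) * T x i) * w i) = 0"
    unfolding det_mat_eq_0_iff by blast
  define z where "z x = (\<Sum>i<m. T x i * w i)" for x
  have "(\<Sum>x\<in>K. cnj (z x) * z x) = (\<Sum>x\<in>K. \<Sum>r<m. cnj (w r) * (cnj (T x r) * z x))"
    by (simp add: z_def[of _] sum_distrib_right sum_distrib_left mult_ac)
  also have "\<dots> = (\<Sum>r<m. cnj (w r) * (\<Sum>x\<in>K. cnj (T x r) * z x))"
    by (subst sum.swap) (simp add: sum_distrib_left)
  also have "\<dots> = (\<Sum>r<m. cnj (w r) * (\<Sum>i<m. (\<Sum>x\<in>K. cnj (T x r) * T x i) * w i))"
    unfolding z_def sum_distrib_left sum_distrib_right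
    by (subst (2) sum.swap) (simp add: mult_ac)
  also have "\<dots> = 0" using w by simp
  finally have "of_real (\<Sum>x\<in>K. (cmod (z x))\<^sup>2) = (0::complex)"
    by (simp only: of_real_sum complex_norm_square mult.commute)
  then have "(\<Sum>x\<in>K. (cmod (z x))\<^sup>2) = 0" by (simp only: of_real_eq_0_iff)
  then have "\<forall>x\<in>K. z x = 0" using \<open>finite K\<close> by (simp add: sum_nonneg_eq_0_iff)
  then show False using inj[of w] nz by (auto simp: z_def)
qed

text \<open>Padded with zero rows, the coefficient matrix becomes a singular square matrix.\<close>

lemma more_unknowns_than_equations:
  fixes M :: "'a \<Rightarrow> 'b \<Rightarrow> complex"
  assumes "finite A" "finite B" "card B < card A"
  shows "\<exists>c. (\<exists>a\<in>A. c a \<noteq> 0) \<and> (\<forall>b\<in>B. (\<Sum>a\<in>A. M a b * c a) = 0)"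
proof -
  let ?n = "card A"
  obtain f where f: "bij_betw f {..<?n} A"
    using ex_bij_betw_nat_finite[OF assms(1)] by (auto simp: lessThan_atLeast0)
  obtain g where g: "bij_betw g {..<card B} B"
    using ex_bij_betw_nat_finite[OF assms(2)] by (auto simp: lessThan_atLeast0)
  define D where "D i j = (if i < card B then M (f j) (g i) else 0)" for i j
  have "det (mat ?n ?n (\<lambda>(i, j). D j i)) = 0"
    unfolding det_mat_eq_0_iff
    by (rule exI[of _ "\<lambda>i. if i < card B then 0 else 1"]) (use assms(3) in \<open>auto simp: D_def intro!: sum.neutral\<close>)
  then have "det (mat ?n ?n (\<lambda>(i, j). D i j)) = 0"
    by (simp only: det_mat_swap[of ?n D])
  then obtain w i where w: "i < ?n" "w i \<noteq> 0" "\<forall>i<?n. (\<Sum>j<?n. D i j * w j) = 0"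
    unfolding det_mat_eq_0_iff by blast
  define c where "c = w \<circ> inv_into {..<?n} f"
  have cf: "c (f j) = w j" if "j < ?n" for j
    using f that by (simp add: c_def bij_betw_inv_into_left)
  have "f i \<in> A" using bij_betw_apply[OF f] w(1) by simp
  moreover have "c (f i) \<noteq> 0" using w(1,2) cf by simp
  ultimately have "\<exists>a\<in>A. c a \<noteq> 0" by blast
  moreover have "(\<Sum>a\<in>A. M a b * c a) = 0" if "b \<in> B" for b
  proof -
    have "b \<in> g ` {..<card B}" using bij_betw_imp_surj_on[OF g] that by (simp only:)
    then obtain i where i: "i < card B" "b = g i" by blast
    have "(\<Sum>a\<in>A. M a b * c a) = (\<Sum>j<?n. M (f j) b * c (f j))"
      by (rule sum.reindex_bij_betw[OF f, symmetric])
    also have "\<dots> = (\<Sum>j<?n. D i j * w j)"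
      using i by (intro sum.cong) (auto simp: D_def cf)
    finally show ?thesis using w(3) i(1) assms(3) by simp
  qed
  ultimately show ?thesis by blast
qed

section \<open>Linear substitutions and cones\<close>

lemma peval_lin_subst:
  "peval v (lin_subst M p) = peval (\<lambda>i. \<Sum>l<dim_col M. M $$ (i, l) * v l) p"
  unfolding lin_subst_def peval_sum peval_mult peval_prod peval_power peval_Const peval_Var
  by (simp add: peval_def)

lemma lin_subst_in_mpolys: "lin_subst M p \<in> mpolys (dim_col M)"
  unfolding lin_subst_def
  by (intro mpolys_sum mpolys_mult mpolys_prod mpolys_power mpolys_Const mpolys_Var) simp

lemma homogeneous_lin_subst:
  assumes "homogeneous d p" shows "homogeneous d (lin_subst M p)"
  unfolding lin_subst_def
proof (intro homogeneous_sum homogeneous_Const_mult)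
  fix a assume "a \<in> Poly_Mapping.keys p"
  then have "(\<Sum>i\<in>Poly_Mapping.keys a. Poly_Mapping.lookup a i * 1) = d"
    using assms by (simp add: homogeneous_def)
  then show "homogeneous d (\<Prod>i\<in>Poly_Mapping.keys a.
      (\<Sum>l<dim_col M. Const (M $$ (i, l)) * Var l) ^ Poly_Mapping.lookup a i)"
    by (metis (no_types, lifting) homogeneous_prod homogeneous_power homogeneous_sum
        homogeneous_Const_mult homogeneous_Var)
qed

lemma invertible_mat_if_det_nonzero:
  fixes M :: "complex mat"
  assumes "M \<in> carrier_mat m m" "det M \<noteq> 0"
  shows "invertible_mat M"
proof -
  have "M \<in> Units (ring_mat TYPE(complex) m ())" by (rule det_non_zero_imp_unit[OF assms])
  then obtain B where "B \<in> carrier_mat m m" "B * M = 1\<^sub>m m" "M * B = 1\<^sub>m m"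
    by (auto simp: Units_def ring_mat_def)
  then show ?thesis using assms(1)
    by (auto simp: invertible_mat_def inverts_mat_def square_mat.simps)
qed

text \<open>If \<open>f\<close> is constant in the direction \<open>w\<close>, then in coordinates whose first basis vector is \<open>w\<close> it does not
  involve the first variable.\<close>

lemma cone_if_derivative_vanishes:
  assumes f: "f \<in> mpolys (Suc n)" and w: "act (linear_form (Suc n) w) f = 0"
    and k: "k \<le> n" "w k \<noteq> 0"
  shows "is_cone n f"
proof -
  \<comment> \<open>The columns are \<open>w\<close> and the unit vectors other than the \<open>k\<close>-th, with the \<open>0\<close>-th in place \<open>k\<close>.
     They form a basis because \<open>w k \<noteq> 0\<close>.\<close>
  define c where "c i l = (if l = 0 then w i else if l = k then (if i = 0 then 1 else 0)
      else if i = l then 1 else 0)" for i l :: nat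
  define M where "M = mat (Suc n) (Suc n) (\<lambda>(i, l). c i l)"
  have M: "M \<in> carrier_mat (Suc n) (Suc n)" by (simp add: M_def)
  have "det M \<noteq> 0"
  proof
    assume "det M = 0"
    then obtain u where nz: "\<exists>i<Suc n. u i \<noteq> 0"
      and u: "\<forall>i<Suc n. (\<Sum>l<Suc n. c i l * u l) = 0"
      unfolding M_def det_mat_eq_0_iff by blast
    have row: "(\<Sum>l<Suc n. c i l * u l) = w i * u 0 + (\<Sum>l\<in>{..<Suc n} - {0}. c i l * u l)" for i
      by (subst sum.remove[of _ 0]) (auto simp: c_def)
    have "(\<Sum>l\<in>{..<Suc n} - {0}. c k l * u l) = 0"
      by (rule sum.neutral) (auto simp: c_def)
    with u row[of k] k have u0: "u 0 = 0" by auto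
    have "u i = 0" if "i < Suc n" for i
    proof (cases "i = 0")
      case False
      let ?r = "if i = k then 0 else i"
      have "(\<Sum>l\<in>{..<Suc n} - {0}. c ?r l * u l) =
          (\<Sum>l\<in>{..<Suc n} - {0}. if l = i then u i else 0)"
        using False by (intro sum.cong) (auto simp: c_def)
      also have "\<dots> = u i" using False that by simp
      finally have "(\<Sum>l\<in>{..<Suc n} - {0}. c ?r l * u l) = u i" .
      moreover have "?r < Suc n" using that by simp
      ultimately show ?thesis using u row[of ?r] u0 by auto
    qed (simp add: u0)
    with nz show False by blast
  qed
  then have inv: "invertible_mat M" by (rule invertible_mat_if_det_nonzero[OF M])
  let ?g = "lin_subst M f"
  have g: "?g \<in> mpolys (Suc n)" using lin_subst_in_mpolys[of M f] by (simp add: M_def)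
  have "peval v (pdiff 0 ?g) = 0" for v
  proof -
    define e where "e i = (if i = 0 then 1 else 0 :: complex)" for i :: nat
    define V where "V i = (\<Sum>l<Suc n. c i l * v l)" for i
    \<comment> \<open>Moving along the first new axis is moving along \<open>w\<close> in the old coordinates.\<close>
    have "peval (\<lambda>i. v i + t * e i) ?g = peval (\<lambda>i. V i + t * w i) f" for t
      unfolding peval_lin_subst
    proof (rule peval_cong[OF f])
      fix i assume i: "i < Suc n"
      have "(\<Sum>l<Suc n. c i l * e l) = (\<Sum>l<Suc n. if l = 0 then w i else 0)"
        by (rule sum.cong) (auto simp: e_def c_def)
      then have "(\<Sum>l<Suc n. c i l * e l) = w i" by simp
      moreover have "(\<Sum>l<dim_col M. M $$ (i, l) * (v l + t * e l)) =
          (\<Sum>l<Suc n. c i l * v l + t * (c i l * e l))"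
        unfolding M_def using i by (intro sum.cong) (auto simp: algebra_simps)
      ultimately show "(\<Sum>l<dim_col M. M $$ (i, l) * (v l + t * e l)) = V i + t * w i"
        by (simp only: sum.distrib V_def sum_distrib_left[symmetric])
    qed
    then have "((\<lambda>t. peval (\<lambda>i. v i + t * e i) ?g) has_field_derivative
        peval (\<lambda>i. V i + 0 * w i) (act (linear_form (Suc n) w) f)) (at 0)"
      using peval_line_deriv[OF f, of V w 0] by simp
    with peval_line_deriv[OF g, of v e 0]
    have "peval v (act (linear_form (Suc n) e) ?g) = 0"
      using DERIV_unique by (fastforce simp: w)
    moreover have "(\<Sum>i<Suc n. e i * peval v (pdiff i ?g)) = (\<Sum>i<Suc n. if i = 0 then peval v (pdiff 0 ?g) else 0)"
      by (rule sum.cong) (auto simp: e_def)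
    ultimately show ?thesis by (simp add: peval_act_linear_form del: sum.lessThan_Suc)
  qed
  then have D: "pdiff 0 ?g = 0" by (rule peval_eq_0_imp_zero)
  have "Poly_Mapping.lookup a 0 = 0" if "Poly_Mapping.lookup ?g a \<noteq> 0" for a
  proof (rule ccontr)
    assume "Poly_Mapping.lookup a 0 \<noteq> 0"
    then have "a = Poly_Mapping.single 0 1 + (a - Poly_Mapping.single 0 1)" by (rule exponent_split)
    then have "dcoeff ?g a = 0" using D by (metis dcoeff_pdiff dcoeff_zero)
    with that show False by (simp add: dcoeff_def)
  qed
  then have "0 \<notin> pvars ?g" by (auto simp: pvars_def in_keys_iff)
  moreover have "pvars ?g \<subseteq> {..<Suc n}" using g by (simp add: mpolys_def)
  ultimately have "pvars ?g \<subseteq> {1..n}" by (force simp: less_Suc_eq_le Suc_le_eq intro!: gr0I)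
  with M inv show ?thesis by (auto simp: is_cone_def)
qed

section \<open>The algebra \<open>A(f)\<close>\<close>

lemma mpolys_uminus: "p \<in> mpolys m \<Longrightarrow> - p \<in> mpolys m"
  by (simp add: mpolys_iff)

lemma cring_mpoly_ring: "cring (mpoly_ring m)"
proof (rule cringI)
  show "abelian_group (mpoly_ring m)"
    by (rule abelian_groupI)
      (auto simp: mpoly_ring_def intro: mpolys_add add.assoc add.commute bexI[OF _ mpolys_uminus])
  show "comm_monoid (mpoly_ring m)"
    by (rule comm_monoidI) (auto simp: mpoly_ring_def intro: mpolys_mult)
qed (simp add: mpoly_ring_def algebra_simps)

lemma ideal_Ann: "ideal (Ann n f) (mpoly_ring (Suc n))"
proof (rule idealI)
  interpret cring "mpoly_ring (Suc n)" by (rule cring_mpoly_ring)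
  show "ring (mpoly_ring (Suc n))" by (rule ring_axioms)
  show "subgroup (Ann n f) (add_monoid (mpoly_ring (Suc n)))"
  proof (rule group.subgroupI)
    show "group (add_monoid (mpoly_ring (Suc n)))" by (rule a_group)
    show "Ann n f \<subseteq> carrier (add_monoid (mpoly_ring (Suc n)))"
      by (auto simp: Ann_def mpoly_ring_def)
    show "Ann n f \<noteq> {}" by (auto simp: Ann_def intro: exI[of _ 0])
  next
    fix a assume a: "a \<in> Ann n f"
    have "\<ominus>\<^bsub>mpoly_ring (Suc n)\<^esub> a = - a"
      using a by (intro minus_equality) (auto simp: mpoly_ring_def Ann_def mpolys_uminus)
    moreover have "- a \<in> Ann n f" using a act_minus[of 0 a f] by (auto simp: Ann_def mpolys_uminus)
    ultimately show "inv\<^bsub>add_monoid (mpoly_ring (Suc n))\<^esub> a \<in> Ann n f"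
      by (simp add: a_inv_def)
  qed (auto simp: Ann_def mpoly_ring_def act_add mpolys_add)
next
  fix a x assume a: "a \<in> Ann n f" and x: "x \<in> carrier (mpoly_ring (Suc n))"
  then have "act (x * a) f = 0" "x * a \<in> mpolys (Suc n)"
    by (auto simp: Ann_def mpoly_ring_def act_mult mpolys_mult)
  then show "x \<otimes>\<^bsub>mpoly_ring (Suc n)\<^esub> a \<in> Ann n f" "a \<otimes>\<^bsub>mpoly_ring (Suc n)\<^esub> x \<in> Ann n f"
    by (auto simp: Ann_def mpoly_ring_def mult.commute)
qed

lemma A_class_eq: "A_class n f \<alpha> = (\<lambda>h. h + \<alpha>) ` Ann n f"
  by (auto simp: A_class_def a_r_coset_def' mpoly_ring_def)

lemma zero_in_Ann [simp]: "0 \<in> Ann n f"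
  by (simp add: Ann_def)

lemma A_act_class [simp]: "A_act (A_class n f \<alpha>) f = act \<alpha> f"
proof -
  have "(\<lambda>\<beta>. act \<beta> f) ` A_class n f \<alpha> = {act \<alpha> f}"
    unfolding A_class_eq image_image using zero_in_Ann[of n f]
    by (auto simp: act_add Ann_def intro!: image_eqI[of _ _ 0])
  then show ?thesis by (simp add: A_act_def)
qed

lemma A_class_eqI:
  assumes "\<alpha> \<in> mpolys (Suc n)" "\<beta> \<in> mpolys (Suc n)" "act \<alpha> f = act \<beta> f"
  shows "A_class n f \<alpha> = A_class n f \<beta>"
proof -
  have sub: "A_class n f \<alpha> \<subseteq> A_class n f \<beta>"
    if "\<alpha> \<in> mpolys (Suc n)" "\<beta> \<in> mpolys (Suc n)" "act \<alpha> f = act \<beta> f" for \<alpha> \<beta>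
  proof
    fix x assume "x \<in> A_class n f \<alpha>"
    then obtain h where h: "h \<in> Ann n f" "x = h + \<alpha>" by (auto simp: A_class_eq)
    have "h + \<alpha> - \<beta> \<in> Ann n f"
      using h that mpolys_add[OF mpolys_add mpolys_uminus, of h "Suc n" \<alpha> \<beta>]
      by (auto simp: Ann_def act_add act_minus)
    then show "x \<in> A_class n f \<beta>" using h(2) by (auto simp: A_class_eq image_iff intro!: bexI[of _ "h + \<alpha> - \<beta>"])
  qed
  show ?thesis using sub[OF assms] sub[OF assms(2,1) assms(3)[symmetric]] by blast
qed

lemma A_class_mult:
  assumes "\<alpha> \<in> mpolys (Suc n)" "\<beta> \<in> mpolys (Suc n)"
  shows "A_class n f \<alpha> \<otimes>\<^bsub>A_ring n f\<^esub> A_class n f \<beta> = A_class n f (\<alpha> * \<beta>)"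
  using ideal.rcoset_mult_add[OF ideal_Ann, of \<alpha> n \<beta> f] assms
  by (simp add: A_ring_def FactRing_def A_class_def) (simp add: mpoly_ring_def)

lemma A_class_add:
  assumes "\<alpha> \<in> mpolys (Suc n)" "\<beta> \<in> mpolys (Suc n)"
  shows "A_class n f \<alpha> \<oplus>\<^bsub>A_ring n f\<^esub> A_class n f \<beta> = A_class n f (\<alpha> + \<beta>)"
proof -
  interpret ideal "Ann n f" "mpoly_ring (Suc n)" by (rule ideal_Ann)
  show ?thesis using a_rcos_sum[of \<alpha> \<beta>] assms
    by (simp add: A_ring_def FactRing_def A_class_def) (simp add: mpoly_ring_def)
qed

lemma A_zero: "\<zero>\<^bsub>A_ring n f\<^esub> = A_class n f 0"
  by (simp add: A_ring_def FactRing_def A_class_eq)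

text \<open>Induction along the list; carrying a polynomial representative \<open>\<gamma>\<close> of \<open>x\<close> makes the ring operations of the
  quotient computable.\<close>

lemma Span_coordinates:
  assumes "set bs \<subseteq> A_class n f ` mpolys (Suc n)"
    and "x \<in> ring.Span (A_ring n f) (A_scalars n f) bs"
  shows "\<exists>\<gamma>\<in>mpolys (Suc n). x = A_class n f \<gamma> \<and>
    (\<exists>c. act \<gamma> f = (\<Sum>i<length bs. Const (c i) * A_act (bs ! i) f))"
  using assms
proof (induction bs arbitrary: x)
  interpret A: ring "A_ring n f"
    unfolding A_ring_def by (rule ideal.quotient_is_ring[OF ideal_Ann])
  case Nil
  then have "x = A_class n f 0" by (simp add: A_zero)
  then show ?case by (intro bexI[of _ 0]) auto
next
  interpret A: ring "A_ring n f"
    unfolding A_ring_def by (rule ideal.quotient_is_ring[OF ideal_Ann])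
  case (Cons b bs)
  obtain \<beta> where \<beta>: "\<beta> \<in> mpolys (Suc n)" "b = A_class n f \<beta>" using Cons.prems(1) by auto
  obtain k y where ky: "k \<in> A_scalars n f" "y \<in> A.Span (A_scalars n f) bs"
      "x = (k \<otimes>\<^bsub>A_ring n f\<^esub> b) \<oplus>\<^bsub>A_ring n f\<^esub> y"
    using Cons.prems(2) by (auto simp: A.line_extension_def set_add_def' r_coset_def)
  obtain e where e: "k = A_class n f (Const e)" using ky(1) by (auto simp: A_scalars_def)
  obtain \<gamma> c where \<gamma>: "\<gamma> \<in> mpolys (Suc n)" "y = A_class n f \<gamma>"
      "act \<gamma> f = (\<Sum>i<length bs. Const (c i) * A_act (bs ! i) f)"
    using Cons.IH[of y] Cons.prems(1) ky(2) by auto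
  have mem: "Const e * \<beta> \<in> mpolys (Suc n)" by (intro mpolys_mult \<beta>(1)) simp
  show ?case
  proof (intro bexI conjI exI)
    show "x = A_class n f (Const e * \<beta> + \<gamma>)"
      by (simp add: ky(3) e \<beta> \<gamma>(1,2) A_class_mult A_class_add mem)
    show "act (Const e * \<beta> + \<gamma>) f =
        (\<Sum>i<length (b # bs). Const (case i of 0 \<Rightarrow> e | Suc i \<Rightarrow> c i) * A_act ((b # bs) ! i) f)"
      by (simp add: sum.lessThan_Suc_shift act_add act_mult \<gamma>(3) \<beta>(2) del: sum.lessThan_Suc)
    show "Const e * \<beta> + \<gamma> \<in> mpolys (Suc n)" by (rule mpolys_add[OF mem \<gamma>(1)])
  qed
qed

lemma A_deg_basis_coordinates:
  assumes "A_deg_basis n f j bs" "\<alpha> \<in> mpolys (Suc n)" "homogeneous j \<alpha>"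
  shows "\<exists>c. act \<alpha> f = (\<Sum>i<length bs. Const (c i) * A_act (bs ! i) f)"
proof -
  have "set bs \<subseteq> A_class n f ` mpolys (Suc n)"
    using assms(1) by (auto simp: A_deg_basis_def A_deg_def)
  moreover have "A_class n f \<alpha> \<in> ring.Span (A_ring n f) (A_scalars n f) bs"
    using assms by (auto simp: A_deg_basis_def A_deg_def)
  ultimately have "\<exists>\<gamma>\<in>mpolys (Suc n). A_class n f \<alpha> = A_class n f \<gamma> \<and>
    (\<exists>c. act \<gamma> f = (\<Sum>i<length bs. Const (c i) * A_act (bs ! i) f))"
    by (rule Span_coordinates)
  then obtain \<gamma> where "A_class n f \<alpha> = A_class n f \<gamma>"
    and c: "\<exists>c. act \<gamma> f = (\<Sum>i<length bs. Const (c i) * A_act (bs ! i) f)"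
    by (elim bexE conjE)
  then have "act \<alpha> f = act \<gamma> f" by (metis A_act_class)
  then show ?thesis using c by simp
qed

lemma A_deg_basis_representatives:
  assumes "A_deg_basis n f j bs"
  obtains al where "\<And>i. i < length bs \<Longrightarrow>
    al i \<in> mpolys (Suc n) \<and> homogeneous j (al i) \<and> bs ! i = A_class n f (al i)"
proof -
  have "\<exists>\<alpha>. i < length bs \<longrightarrow>
      \<alpha> \<in> mpolys (Suc n) \<and> homogeneous j \<alpha> \<and> bs ! i = A_class n f \<alpha>" for i
  proof (cases "i < length bs")
    case True
    then have "bs ! i \<in> A_deg n f j" using assms nth_mem[OF True] unfolding A_deg_basis_def by blast
    then show ?thesis unfolding A_deg_def by blast
  qed simp
  then show ?thesis using that by metis
qed

section \<open>Multiplication by a general linear form\<close>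

lemma linear_form_of_homogeneous:
  assumes "homogeneous 1 \<xi>" "\<xi> \<in> mpolys m"
  shows "\<xi> = linear_form m (\<lambda>i. Poly_Mapping.lookup \<xi> (Poly_Mapping.single i 1))"
proof (rule poly_mapping_eqI)
  fix a
  let ?s = "\<lambda>i. Poly_Mapping.single i (1::nat)"
  have eq: "Poly_Mapping.lookup (linear_form m w) a = (\<Sum>i<m. if ?s i = a then w i else 0)" for w
    by (simp add: linear_form_def lookup_sum Var_def lookup_single when_def if_distrib cong: if_cong)
  have inj: "?s i = ?s l \<longleftrightarrow> i = l" for i l
    by (metis lookup_single_eq lookup_single_not_eq zero_neq_one)
  show "Poly_Mapping.lookup \<xi> a =
      Poly_Mapping.lookup (linear_form m (\<lambda>i. Poly_Mapping.lookup \<xi> (?s i))) a"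
  proof (cases "\<exists>l<m. ?s l = a")
    case True
    then obtain l where l: "l < m" "a = ?s l" by blast
    have "(\<Sum>i<m. if ?s i = a then Poly_Mapping.lookup \<xi> (?s i) else 0) =
        (\<Sum>i<m. if i = l then Poly_Mapping.lookup \<xi> a else 0)"
      unfolding l(2) inj by (intro sum.cong) auto
    then show ?thesis unfolding eq using l(1) by simp
  next
    case False
    have "Poly_Mapping.lookup \<xi> a = 0"
    proof (rule ccontr)
      assume a: "Poly_Mapping.lookup \<xi> a \<noteq> 0"
      then have deg: "mdeg a = 1" using assms(1) by (simp add: homogeneous_iff)
      then have "a \<noteq> 0" by (metis mdeg_zero zero_neq_one)
      then obtain l where l: "Poly_Mapping.lookup a l \<noteq> 0"
        by (metis lookup_zero poly_mapping_eqI)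
      then have split: "a = ?s l + (a - ?s l)" by (rule exponent_split)
      have "mdeg (a - ?s l) = 0" using arg_cong[OF split, of mdeg] deg unfolding mdeg_add mdeg_single by linarith
      then have "a - ?s l = 0" by (simp only: mdeg_eq_0_iff)
      then have "a = ?s l" using split by simp
      moreover have "l \<in> Poly_Mapping.keys a" using l by (simp add: in_keys_iff)
      then have "l < m" using a assms(2) unfolding mpolys_iff by blast
      ultimately show False using False by blast
    qed
    moreover have "(\<Sum>i<m. if ?s i = a then Poly_Mapping.lookup \<xi> (?s i) else 0) = 0"
      using False by (intro sum.neutral) auto
    ultimately show ?thesis unfolding eq by simp
  qed
qed

text \<open>\<open>A\<^sub>0\<close> consists of constants, and \<open>X\<^sub>0(f) \<noteq> 0\<close> as \<open>f\<close> is not a cone. This makes the set of admissible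
  \<open>k\<close> nonempty, so that its greatest element belongs to it.\<close>

lemma injective_mult_into_one:
  assumes f: "f \<in> mpolys (Suc n)" and cone: "\<not> is_cone n f"
  shows "injective_mult_into n f 1"
proof -
  have V: "Var 0 \<in> mpolys (Suc n)" by (rule mpolys_Var) simp
  have nz: "pdiff 0 f \<noteq> 0"
  proof
    assume *: "pdiff 0 f = 0"
    have "act (linear_form (Suc n) (\<lambda>i. if i = 0 then 1 else 0)) f =
        (\<Sum>i<Suc n. if i = 0 then pdiff 0 f else 0)"
      unfolding act_linear_form by (rule sum.cong) (auto simp: Const_def)
    then have "act (linear_form (Suc n) (\<lambda>i. if i = 0 then 1 else 0)) f = 0"
      using * by simp
    then show False using cone cone_if_derivative_vanishes[OF f, of _ 0] by fastforce
  qed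
  have const: "\<alpha> = Const (Poly_Mapping.lookup \<alpha> 0)" if "homogeneous 0 \<alpha>" for \<alpha>
    using that mdeg_eq_0_iff unfolding homogeneous_iff
    by (intro poly_mapping_eqI) (auto simp: Const_def lookup_single when_def)
  show ?thesis unfolding injective_mult_into_def
  proof (rule bexI[of _ "A_class n f (Var 0)"])
    show "A_class n f (Var 0) \<in> A_deg n f 1" unfolding A_deg_def using V homogeneous_Var by blast
    show "inj_on ((\<otimes>\<^bsub>A_ring n f\<^esub>) (A_class n f (Var 0))) (A_deg n f (1 - 1))"
    proof (rule inj_onI)
      fix x y assume "x \<in> A_deg n f (1 - 1)" "y \<in> A_deg n f (1 - 1)"
        and eq: "A_class n f (Var 0) \<otimes>\<^bsub>A_ring n f\<^esub> x = A_class n f (Var 0) \<otimes>\<^bsub>A_ring n f\<^esub> y"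
      then obtain \<alpha> \<beta> where "homogeneous 0 \<alpha>" "homogeneous 0 \<beta>"
          and xy: "x = A_class n f \<alpha>" "y = A_class n f \<beta>"
        by (auto simp: A_deg_def)
      then obtain a b where ab: "\<alpha> = Const a" "\<beta> = Const b" using const by blast
      have "A_act (A_class n f (Var 0 * Const a)) f = A_act (A_class n f (Var 0 * Const b)) f"
        using eq by (simp add: xy ab A_class_mult V)
      then have "Const a * pdiff 0 f = Const b * pdiff 0 f"
        by (simp add: act_mult act_Const_mult_right act_Var)
      then have "\<forall>m. a * Poly_Mapping.lookup (pdiff 0 f) m = b * Poly_Mapping.lookup (pdiff 0 f) m"
        by (metis lookup_Const_mult)
      then have "a = b" using nz by (metis lookup_zero mult_right_cancel poly_mapping_eqI)
      then show "x = y" by (simp add: xy ab)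
    qed
  qed
qed

lemma injective_mult_into_linear_form:
  assumes "injective_mult_into n f k"
  obtains q where "\<And>\<alpha>. \<lbrakk>\<alpha> \<in> mpolys (Suc n); homogeneous (k - 1) \<alpha>;
    act (linear_form (Suc n) q) (act \<alpha> f) = 0\<rbrakk> \<Longrightarrow> act \<alpha> f = 0"
proof -
  obtain \<xi> where l: "\<xi> \<in> mpolys (Suc n)" "homogeneous 1 \<xi>"
    and inj: "inj_on (\<lambda>a. A_class n f \<xi> \<otimes>\<^bsub>A_ring n f\<^esub> a) (A_deg n f (k - 1))"
    using assms by (auto simp: injective_mult_into_def A_deg_def)
  obtain q where q: "\<xi> = linear_form (Suc n) q"
    using linear_form_of_homogeneous[OF l(2,1)] by blast
  show ?thesis
  proof (rule that)
    fix \<alpha> assume a: "\<alpha> \<in> mpolys (Suc n)" "homogeneous (k - 1) \<alpha>"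
      "act (linear_form (Suc n) q) (act \<alpha> f) = 0"
    have "A_class n f (\<xi> * \<alpha>) = A_class n f (\<xi> * 0)"
      using a l(1) by (intro A_class_eqI mpolys_mult) (auto simp: act_mult q)
    then have "A_class n f \<xi> \<otimes>\<^bsub>A_ring n f\<^esub> A_class n f \<alpha> = A_class n f \<xi> \<otimes>\<^bsub>A_ring n f\<^esub> A_class n f 0"
      using a(1) l(1) by (simp add: A_class_mult)
    then have "A_class n f \<alpha> = A_class n f 0"
      using inj a(1,2) by (elim inj_onD) (auto simp: A_deg_def)
    then have "A_act (A_class n f \<alpha>) f = A_act (A_class n f 0) f" by simp
    then show "act \<alpha> f = 0" by simp
  qed
qed

text \<open>If \<open>L \<alpha> = 0\<close> in degree \<open>i + 1\<close>, then \<open>L\<close> also kills all \<open>X\<^sub>r \<alpha>\<close>. By injectivity one degree higher these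
  vanish on \<open>f\<close>, so \<open>\<alpha>(f)\<close> is a form of positive degree \<open>d - i\<close> without nonzero derivatives.\<close>

lemma injective_mult_descends:
  assumes f: "f \<in> mpolys m" "homogeneous d f" and "k \<le> d"
    and inj: "\<And>\<alpha>. \<lbrakk>\<alpha> \<in> mpolys m; homogeneous k \<alpha>;
      act (linear_form m q) (act \<alpha> f) = 0\<rbrakk> \<Longrightarrow> act \<alpha> f = 0"
    and "i \<le> k"
    and \<alpha>: "\<alpha> \<in> mpolys m" "homogeneous i \<alpha>" "act (linear_form m q) (act \<alpha> f) = 0"
  shows "act \<alpha> f = 0"
  using \<open>i \<le> k\<close> \<alpha>
proof (induction arbitrary: \<alpha> rule: inc_induct)
  case base
  then show ?case by (rule inj)
next
  case (step i)
  show ?case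
  proof (rule homogeneous_pdiff_eq_0)
    show "homogeneous (d - i) (act \<alpha> f)" by (rule homogeneous_act[OF step.prems(2) f(2)])
    show "d - i > 0" using step.hyps \<open>k \<le> d\<close> by simp
    show "act \<alpha> f \<in> mpolys m" by (rule act_in_mpolys[OF f(1)])
    fix r assume r: "r < m"
    have "act (Var r * \<alpha>) f = 0"
    proof (rule step.IH)
      show "Var r * \<alpha> \<in> mpolys m" by (intro mpolys_mult mpolys_Var r step.prems)
      show "homogeneous (Suc i) (Var r * \<alpha>)"
        using homogeneous_mult[OF homogeneous_Var step.prems(2)] by simp
      have "act (linear_form m q) (act (Var r * \<alpha>) f) = act (Var r) (act (linear_form m q) (act \<alpha> f))"
        by (simp only: act_mult act_commute[of "linear_form m q"])
      then show "act (linear_form m q) (act (Var r * \<alpha>) f) = 0" using step.prems(3) by simp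
    qed
    then show "pdiff r (act \<alpha> f) = 0" by (simp add: act_mult act_Var)
  qed
qed

lemma injective_mult_power:
  assumes inj: "\<And>i \<alpha>. \<lbrakk>i \<le> k; \<alpha> \<in> mpolys m; homogeneous i \<alpha>;
      act (linear_form m q) (act \<alpha> f) = 0\<rbrakk> \<Longrightarrow> act \<alpha> f = 0"
    and "r + i \<le> Suc k" "\<alpha> \<in> mpolys m" "homogeneous i \<alpha>"
    and "act (linear_form m q ^ r) (act \<alpha> f) = 0"
  shows "act \<alpha> f = 0"
  using assms(2-)
proof (induction r)
  case 0
  then show ?case using act_Const[of 1 "act \<alpha> f"] by (simp add: Const_def)
next
  case (Suc r)
  have "act (linear_form m q ^ r * \<alpha>) f = 0"
  proof (rule inj)
    show "r + i \<le> k" using Suc.prems by simp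
    show "linear_form m q ^ r * \<alpha> \<in> mpolys m"
      by (intro mpolys_mult mpolys_power linear_form_in_mpolys Suc.prems)
    show "homogeneous (r + i) (linear_form m q ^ r * \<alpha>)"
      using homogeneous_mult[OF homogeneous_power[OF homogeneous_linear_form] Suc.prems(3)] by simp
    show "act (linear_form m q) (act (linear_form m q ^ r * \<alpha>) f) = 0"
      using Suc.prems(4) by (simp add: act_mult)
  qed
  then show ?case using Suc.prems by (intro Suc.IH) (simp_all add: act_mult)
qed

lemma line_poly_act_power:
  "line_poly (\<lambda>q. Poly_Mapping.lookup (act (linear_form m q ^ e) g) a)"
proof (induction e arbitrary: a)
  case 0
  show ?case by (simp add: line_poly_const)
next
  case (Suc e)
  have "Poly_Mapping.lookup (act (linear_form m q ^ Suc e) g) a = (\<Sum>i<m. q i *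
      (of_nat (Suc (Poly_Mapping.lookup a i)) *
       Poly_Mapping.lookup (act (linear_form m q ^ e) g) (a + Poly_Mapping.single i 1)))" for q
    by (simp only: power_Suc act_mult act_linear_form lookup_sum lookup_Const_mult lookup_pdiff)
  then show ?case
    by (simp only:) (intro line_poly_sum line_poly_mult line_poly_coord line_poly_const Suc)
qed

text \<open>The condition that \<open>L\<^sub>p\<^sup>e\<close> is injective on linear forms is open in \<open>p\<close>. As certificate \<open>D\<close> serves the determinant of
  \<open>T(q)\<^sup>* T(p)\<close>, where \<open>T(p)\<close> is the coefficient matrix of \<open>w \<mapsto> L\<^sub>p\<^sup>e L\<^sub>w f\<close>. The left factor is taken
  at the fixed point \<open>q\<close> to keep the entries polynomial in \<open>p\<close>, without complex conjugates of the variable.\<close>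

lemma injective_power_generic:
  assumes inj: "\<And>w. act (linear_form m q ^ e * linear_form m w) f = 0 \<Longrightarrow> \<forall>i<m. w i = 0"
  obtains D where "line_poly D" "D q \<noteq> 0"
    "\<And>p w. \<lbrakk>D p \<noteq> 0; act (linear_form m p ^ e * linear_form m w) f = 0\<rbrakk> \<Longrightarrow> \<forall>i<m. w i = 0"
proof -
  define T where "T p a i = Poly_Mapping.lookup (act (linear_form m p ^ e) (pdiff i f)) a" for p a i
  define K where "K = (\<Union>i<m. Poly_Mapping.keys (act (linear_form m q ^ e) (pdiff i f)))"
  have T: "Poly_Mapping.lookup (act (linear_form m p ^ e * linear_form m w) f) a =
      (\<Sum>i<m. T p a i * w i)" for p w a
    by (simp add: act_mult act_linear_form act_sum_right act_Const_mult_right lookup_sum T_def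
        mult.commute[of "w _"])
  define D where "D p = det (mat m m (\<lambda>(r, i). \<Sum>a\<in>K. cnj (T q a r) * T p a i))" for p
  show ?thesis
  proof (rule that)
    have "line_poly (\<lambda>p. det (mat m m (\<lambda>(r, i). \<Sum>a\<in>K. cnj (T q a r) * T p a i)))"
      by (intro line_poly_det line_poly_sum line_poly_mult line_poly_const)
        (unfold T_def, rule line_poly_act_power)
    then show "line_poly D" by (simp only: D_def[abs_def])
    show "D q \<noteq> 0" unfolding D_def
    proof (rule gram_det_nonzero)
      show "finite K" by (simp add: K_def)
      fix w assume w: "\<And>a. a \<in> K \<Longrightarrow> (\<Sum>i<m. T q a i * w i) = 0"
      have "(\<Sum>i<m. T q a i * w i) = 0" for a
      proof (cases "a \<in> K")
        case False
        then have "\<forall>i<m. T q a i = 0" by (auto simp: K_def T_def in_keys_iff)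
        then show ?thesis by simp
      qed (rule w)
      then have "act (linear_form m q ^ e * linear_form m w) f = 0"
        by (intro poly_mapping_eqI) (simp add: T)
      then show "\<forall>i<m. w i = 0" by (rule inj)
    qed
    fix p w assume D: "D p \<noteq> 0" and "act (linear_form m p ^ e * linear_form m w) f = 0"
    then have 0: "(\<Sum>i<m. T p a i * w i) = 0" for a by (simp flip: T)
    have "(\<Sum>i<m. (\<Sum>a\<in>K. cnj (T q a r) * T p a i) * w i) =
        (\<Sum>a\<in>K. cnj (T q a r) * (\<Sum>i<m. T p a i * w i))" for r
      unfolding sum_distrib_left sum_distrib_right by (subst sum.swap) (simp add: mult.assoc)
    then have "(\<Sum>i<m. (\<Sum>a\<in>K. cnj (T q a r) * T p a i) * w i) = 0" for r by (simp add: 0)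
    then show "\<forall>i<m. w i = 0" using D unfolding D_def det_mat_eq_0_iff by blast
  qed
qed

text \<open>Let \<open>w\<close> be in the kernel of the Jacobian matrix at \<open>p\<close> and \<open>\<alpha> = L\<^sub>p\<^bsup>j-1\<^esup> L\<^sub>w \<in> A\<^sub>j\<close>. By Euler's formula
  \<open>(d - 2j)! (\<alpha>\<^sub>l \<alpha> f)(p)\<close> and \<open>(d - j - 1)! (\<alpha>\<^sub>l L\<^sub>w f)(p) = 0\<close> are the same number, namely the value at \<open>p\<close> of
  \<open>L\<^sub>p\<^bsup>d-j-1\<^esup> \<alpha>\<^sub>l L\<^sub>w f\<close>. So the coordinate vector of \<open>\<alpha>\<close> lies in the kernel of the Hessian matrix at \<open>p\<close>.\<close>

lemma polar_jacobian_injective_at: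
  assumes f: "f \<in> mpolys (Suc n)" "homogeneous d f" and j: "1 \<le> j" "2 * j \<le> d"
    and bs: "A_deg_basis n f j bs"
    and al: "\<And>i. i < length bs \<Longrightarrow>
      al i \<in> mpolys (Suc n) \<and> homogeneous j (al i) \<and> bs ! i = A_class n f (al i)"
    and det: "det (mat (length bs) (length bs) (\<lambda>(i, l). peval p (act (al i * al l) f))) \<noteq> 0"
    and inj: "act (linear_form (Suc n) p ^ (j - 1) * linear_form (Suc n) w) f = 0 \<Longrightarrow> \<forall>i\<le>n. w i = 0"
    and w: "\<And>l. l < length bs \<Longrightarrow> peval p (act (linear_form (Suc n) w) (act (al l) f)) = 0"
  shows "\<forall>i\<le>n. w i = 0"
proof -
  let ?L = "linear_form (Suc n) p"
  define \<alpha> where "\<alpha> = ?L ^ (j - 1) * linear_form (Suc n) w"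
  have \<alpha>: "\<alpha> \<in> mpolys (Suc n)" unfolding \<alpha>_def
    by (intro mpolys_mult mpolys_power linear_form_in_mpolys)
  have hom: "homogeneous j \<alpha>"
    using homogeneous_mult[OF homogeneous_power[OF homogeneous_linear_form, of "j - 1"] homogeneous_linear_form] j(1)
    by (simp add: \<alpha>_def)
  obtain c where c: "act \<alpha> f = (\<Sum>i<length bs. Const (c i) * A_act (bs ! i) f)"
    using A_deg_basis_coordinates[OF bs \<alpha> hom] by blast
  have c': "act \<alpha> f = (\<Sum>i<length bs. Const (c i) * act (al i) f)"
    unfolding c using al by (intro sum.cong) auto
  have zero: "(\<Sum>i<length bs. peval p (act (al l * al i) f) * c i) = 0" if l: "l < length bs" for l
  proof -
    have "homogeneous (d - 2 * j) (act (al l * \<alpha>) f)"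
      using homogeneous_act[OF homogeneous_mult[OF _ hom] f(2), of j "al l"] al[OF l] by (simp add: mult_2)
    then have "fact (d - 2 * j) * peval p (act (al l * \<alpha>) f) =
        peval p (act (?L ^ (d - 2 * j)) (act (al l * \<alpha>) f))"
      by (rule euler_formula_power[OF _ act_in_mpolys[OF f(1)], symmetric])
    also have "act (?L ^ (d - 2 * j)) (act (al l * \<alpha>) f) =
        act (?L ^ (d - 2 * j) * ?L ^ (j - 1)) (act (linear_form (Suc n) w * al l) f)"
      by (simp only: act_mult[symmetric] \<alpha>_def mult_ac)
    also have "?L ^ (d - 2 * j) * ?L ^ (j - 1) = ?L ^ (d - (1 + j))"
      using j by (simp flip: power_add)
    also have "peval p (act (?L ^ (d - (1 + j))) (act (linear_form (Suc n) w * al l) f)) =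
        fact (d - (1 + j)) * peval p (act (linear_form (Suc n) w * al l) f)"
    proof (rule euler_formula_power[OF _ act_in_mpolys[OF f(1)]])
      show "homogeneous (d - (1 + j)) (act (linear_form (Suc n) w * al l) f)"
        using al[OF l] by (intro homogeneous_act homogeneous_mult f homogeneous_linear_form) auto
    qed
    also have "\<dots> = 0" using w[OF l] by (simp add: act_mult)
    finally have "peval p (act (al l * \<alpha>) f) = 0" by simp
    moreover have "act (al l * \<alpha>) f = (\<Sum>i<length bs. Const (c i) * act (al l * al i) f)"
      by (simp add: act_mult c' act_sum_right act_Const_mult_right)
    ultimately show ?thesis by (simp add: peval_sum peval_mult mult.commute)
  qed
  have "\<forall>i<length bs. c i = 0"
    using det zero unfolding det_mat_eq_0_iff by blast
  then have "act \<alpha> f = 0" by (simp add: c' Const_def)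
  then show ?thesis using inj by (simp add: \<alpha>_def)
qed

lemma comm_ring_hom_peval: "comm_ring_hom (peval v)"
  by unfold_locales (simp_all add: peval_add peval_mult)

text \<open>A point \<open>p\<close> is chosen at which three nonzero polynomial functions do not vanish: the Hessian determinant, the
  certificate for the injectivity of \<open>L\<^sub>p\<^bsup>j-1\<^esup>\<close> on \<open>A\<^sub>1\<close>, and the first coordinate. The last one is only a
  normalisation, which allows the flag through \<open>p\<close> below to consist of \<open>p\<close> and unit vectors.\<close>

lemma polar_jacobian_injective:
  assumes f: "f \<in> mpolys (Suc n)" "homogeneous d f" and "\<not> is_cone n f"
    and j: "1 \<le> j" "j \<le> k" "2 * k \<le> d" and k: "injective_mult_into n f k"
    and bs: "A_deg_basis n f j bs"
    and hess: "hess n f bs \<noteq> 0"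
  obtains p where "p 0 \<noteq> 0"
    "\<And>w. (\<And>l. l < length bs \<Longrightarrow> peval p (act (linear_form (Suc n) w) (A_act (bs ! l) f)) = 0)
      \<Longrightarrow> \<forall>i\<le>n. w i = 0"
proof -
  let ?N = "length bs"
  obtain al where al: "\<And>i. i < ?N \<Longrightarrow>
      al i \<in> mpolys (Suc n) \<and> homogeneous j (al i) \<and> bs ! i = A_class n f (al i)"
    by (rule A_deg_basis_representatives[OF bs]) blast
  have cone: "\<forall>i<Suc n. w i = 0" if "act (linear_form (Suc n) w) f = 0" for w
    using cone_if_derivative_vanishes[OF f(1) that] assms(3) by (metis less_Suc_eq_le)
  obtain q where q: "\<And>\<alpha>. \<lbrakk>\<alpha> \<in> mpolys (Suc n); homogeneous (k - 1) \<alpha>;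
      act (linear_form (Suc n) q) (act \<alpha> f) = 0\<rbrakk> \<Longrightarrow> act \<alpha> f = 0"
    by (rule injective_mult_into_linear_form[OF k]) blast
  have q': "act \<alpha> f = 0" if "i \<le> k - 1" "\<alpha> \<in> mpolys (Suc n)" "homogeneous i \<alpha>"
      "act (linear_form (Suc n) q) (act \<alpha> f) = 0" for i \<alpha>
    by (rule injective_mult_descends[OF f _ q that]) (use j in auto)
  have inj: "\<forall>i<Suc n. w i = 0" if "act (linear_form (Suc n) q ^ (j - 1) * linear_form (Suc n) w) f = 0" for w
  proof (rule cone, rule injective_mult_power)
    show "j - 1 + 1 \<le> Suc (k - 1)" using j by simp
    show "act (linear_form (Suc n) q ^ (j - 1)) (act (linear_form (Suc n) w) f) = 0"
      using that by (simp add: act_mult)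
    show "homogeneous 1 (linear_form (Suc n) w)" by (rule homogeneous_linear_form)
  qed (use q' in auto)
  obtain D where D: "line_poly D" "D q \<noteq> 0"
    "\<And>p w. \<lbrakk>D p \<noteq> 0; act (linear_form (Suc n) p ^ (j - 1) * linear_form (Suc n) w) f = 0\<rbrakk> \<Longrightarrow> \<forall>i<Suc n. w i = 0"
    by (rule injective_power_generic[OF inj]) blast+
  define H where "H p = det (mat ?N ?N (\<lambda>(i, l). peval p (act (al i * al l) f)))" for p
  have H_hess: "peval p (hess n f bs) = H p" for p
  proof -
    interpret comm_ring_hom "peval p" by (rule comm_ring_hom_peval)
    have "map_mat (peval p) (Hess_mat n f bs) = mat ?N ?N (\<lambda>(i, l). peval p (act (al i * al l) f))"
      by (rule eq_matI) (use al in \<open>auto simp: Hess_mat_def A_class_mult\<close>)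
    then show ?thesis by (simp add: hess_def H_def flip: hom_det)
  qed
  obtain p0 where p0: "H p0 \<noteq> 0" using hess peval_eq_0_imp_zero by (metis H_hess)
  have "line_poly (\<lambda>p. det (mat ?N ?N (\<lambda>(i, l). peval p (act (al i * al l) f))))"
    by (intro line_poly_det line_poly_peval line_poly_coord)
  then have H: "line_poly H" by (simp only: H_def[abs_def])
  obtain p1 where p1: "D p1 \<noteq> 0" "H p1 \<noteq> 0"
    using line_poly_common_nonzero[OF D(1) H D(2) p0] by blast
  obtain p where p: "D p * H p \<noteq> 0" "p 0 \<noteq> 0"
    using line_poly_common_nonzero[OF line_poly_mult[OF D(1) H] line_poly_coord[of 0], of p1 "\<lambda>_. 1"] p1
    by auto
  show ?thesis
  proof (rule that[of p])
    show "p 0 \<noteq> 0" by (rule p(2))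
    fix w assume w: "\<And>l. l < ?N \<Longrightarrow> peval p (act (linear_form (Suc n) w) (A_act (bs ! l) f)) = 0"
    show "\<forall>i\<le>n. w i = 0"
    proof (rule polar_jacobian_injective_at[OF f j(1) _ bs al])
      show "2 * j \<le> d" using j by simp
      show "det (mat ?N ?N (\<lambda>(i, l). peval p (act (al i * al l) f))) \<noteq> 0"
        using p(1) by (simp add: H_def)
      show "\<forall>i\<le>n. w i = 0" if "act (linear_form (Suc n) p ^ (j - 1) * linear_form (Suc n) w) f = 0"
        using D(3)[OF _ that] p(1) by (simp add: less_Suc_eq_le)
      show "peval p (act (linear_form (Suc n) w) (act (al l) f)) = 0" if "l < ?N" for l
        using w[OF that] al[OF that] by simp
    qed
  qed
qed

section \<open>Algebraic dependence of forms\<close>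

text \<open>The last exponent of a monomial of degree \<open>N\<close> is determined by the others, which are at most \<open>N\<close>. The crude
  bound is enough; what matters is that the exponent of \<open>N + 1\<close> is one less than the number of variables.\<close>

lemma card_monomials:
  fixes m N :: nat
  defines "B \<equiv> {b :: nat \<Rightarrow>\<^sub>0 nat. Poly_Mapping.keys b \<subseteq> {..<Suc m} \<and> mdeg b = N}"
  shows "finite B" "card B \<le> (N + 1) ^ m"
proof -
  define \<rho> where "\<rho> b = restrict (Poly_Mapping.lookup b) {..<m}" for b :: "nat \<Rightarrow>\<^sub>0 nat"
  let ?P = "PiE {..<m} (\<lambda>_. {..N})"
  have deg: "mdeg b = (\<Sum>i<Suc m. Poly_Mapping.lookup b i)" if "b \<in> B" for b
    using that by (intro mdeg_superset) (auto simp: B_def)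
  have inj: "inj_on \<rho> B"
  proof (rule inj_onI, rule poly_mapping_eqI)
    fix a b k assume ab: "a \<in> B" "b \<in> B" "\<rho> a = \<rho> b"
    have low: "Poly_Mapping.lookup a i = Poly_Mapping.lookup b i" if "i < m" for i
      using fun_cong[OF ab(3), of i] that by (simp add: \<rho>_def)
    have "mdeg a = mdeg b" using ab by (simp add: B_def)
    then have "Poly_Mapping.lookup a m = Poly_Mapping.lookup b m"
      using low by (simp add: deg ab)
    moreover have "Poly_Mapping.lookup c k = 0" if "c \<in> B" "k > m" for c
      using that by (force simp: B_def in_keys_iff)
    ultimately show "Poly_Mapping.lookup a k = Poly_Mapping.lookup b k"
      using low ab by (metis nat_neq_iff)
  qed
  have sub: "\<rho> ` B \<subseteq> ?P"
  proof
    fix g assume "g \<in> \<rho> ` B"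
    then obtain b where b: "b \<in> B" "g = \<rho> b" by blast
    have "Poly_Mapping.lookup b i \<le> N" if "i < m" for i
    proof -
      have "Poly_Mapping.lookup b i \<le> (\<Sum>i<Suc m. Poly_Mapping.lookup b i)"
        using that by (intro member_le_sum) auto
      then show ?thesis using deg[OF b(1)] b(1) by (simp add: B_def)
    qed
    then show "g \<in> ?P" by (auto simp: b(2) \<rho>_def)
  qed
  have fin: "finite ?P" by (intro finite_PiE) auto
  show "finite B" by (rule inj_on_finite[OF inj sub fin])
  have "card B \<le> card ?P" by (rule card_inj_on_le[OF inj sub fin])
  then show "card B \<le> (N + 1) ^ m" by (simp add: card_PiE)
qed

text \<open>There are at least \<open>(K + 1)\<^bsup>m+1\<^esup>\<close> monomials of degree \<open>D = (m + 1) K\<close> in \<open>m + 2\<close> unknowns: prescribe the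
  first \<open>m + 1\<close> exponents up to \<open>K\<close>, and let the last one fill up the degree. Substituting the forms sends them into
  the forms of degree \<open>e D\<close> in \<open>m + 1\<close> variables, a space whose dimension grows only like \<open>K\<^sup>m\<close>. For large \<open>K\<close>
  there is a linear relation.\<close>

lemma forms_algebraically_dependent:
  fixes P :: "nat \<Rightarrow> mpoly"
  assumes P: "\<And>r. r < Suc (Suc m) \<Longrightarrow> P r \<in> mpolys (Suc m) \<and> homogeneous e (P r)"
  obtains h D where "h \<noteq> 0" "h \<in> mpolys (Suc (Suc m))" "homogeneous D h"
    "\<And>s. peval (\<lambda>r. peval s (P r)) h = 0"
proof -
  \<comment> \<open>The number of equations is at most \<open>(e D + 1)\<^sup>m \<le> ((e (m + 1) + 1) (K + 1))\<^sup>m = K (K + 1)\<^sup>m\<close>.\<close>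
  define K where "K = (e * Suc m + 1) ^ m"
  define D where "D = Suc m * K"
  define A where "A = PiE {..<Suc m} (\<lambda>_. {..K})"
  define B where "B = {b :: nat \<Rightarrow>\<^sub>0 nat. Poly_Mapping.keys b \<subseteq> {..<Suc m} \<and> mdeg b = e * D}"
  define x where "x a = (\<Sum>i<Suc m. Poly_Mapping.single i (a i)) +
    Poly_Mapping.single (Suc m) (D - (\<Sum>i<Suc m. a i))" for a :: "nat \<Rightarrow> nat"
  have lookup_x: "Poly_Mapping.lookup (x a) i =
      (if i < Suc m then a i else if i = Suc m then D - (\<Sum>i<Suc m. a i) else 0)" for a i
  proof -
    have "(\<Sum>l<Suc m. Poly_Mapping.lookup (Poly_Mapping.single l (a l)) i) =
        (\<Sum>l<Suc m. if l = i then a i else 0)"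
      by (rule sum.cong) (auto simp: lookup_single when_def)
    then show ?thesis
      by (auto simp: x_def lookup_add lookup_sum lookup_single when_def simp del: sum.lessThan_Suc)
  qed
  have keys_x: "Poly_Mapping.keys (x a) \<subseteq> {..<Suc (Suc m)}" for a
    by (auto simp: in_keys_iff lookup_x split: if_splits)
  have deg_x: "mdeg (x a) = D" if "a \<in> A" for a
  proof -
    have "(\<Sum>i<Suc m. a i) \<le> (\<Sum>i<Suc m. K)"
      using that by (intro sum_mono) (auto simp: A_def)
    then have "(\<Sum>i<Suc m. a i) \<le> D" by (simp add: D_def del: sum.lessThan_Suc)
    moreover have "mdeg (x a) = (\<Sum>i<Suc m. a i) + (D - (\<Sum>i<Suc m. a i))"
      unfolding mdeg_superset[OF finite_lessThan keys_x] sum.lessThan_Suc[of _ "Suc m"]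
      by (intro arg_cong2[where f = "(+)"] sum.cong) (simp_all add: lookup_x)
    ultimately show ?thesis by simp
  qed
  have inj_x: "inj_on x A"
  proof (rule inj_onI)
    fix a b assume "a \<in> A" "b \<in> A" and eq: "x a = x b"
    moreover have "a i = b i" if "i < Suc m" for i
      using arg_cong[OF eq, of "\<lambda>y. Poly_Mapping.lookup y i"] that by (simp add: lookup_x)
    ultimately show "a = b" unfolding A_def by (intro PiE_ext) auto
  qed
  have fin: "finite A" unfolding A_def by (intro finite_PiE) auto
  have B: "finite B" "card B \<le> (e * D + 1) ^ m"
    unfolding B_def using card_monomials[of m "e * D"] by auto
  have "e * D + 1 \<le> (e * Suc m + 1) * (K + 1)" by (simp add: D_def algebra_simps)
  then have "card B \<le> ((e * Suc m + 1) * (K + 1)) ^ m"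
    using B(2) power_mono order_trans by blast
  also have "\<dots> = K * (K + 1) ^ m" by (simp only: power_mult_distrib K_def)
  also have "\<dots> < (K + 1) ^ Suc m" by simp
  also have "\<dots> = card A" by (simp add: A_def card_PiE)
  finally have less: "card B < card A" .
  define M where "M a = (\<Prod>r<Suc (Suc m). P r ^ Poly_Mapping.lookup (x a) r)" for a
  have M: "M a \<in> mpolys (Suc m)" "homogeneous (e * D) (M a)" if "a \<in> A" for a
  proof -
    show "M a \<in> mpolys (Suc m)" unfolding M_def using P by (intro mpolys_prod mpolys_power) auto
    have "homogeneous (\<Sum>r<Suc (Suc m). Poly_Mapping.lookup (x a) r * e) (M a)"
      unfolding M_def using P by (intro homogeneous_prod homogeneous_power) auto
    moreover have "(\<Sum>r<Suc (Suc m). Poly_Mapping.lookup (x a) r * e) = e * D"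
      using deg_x[OF that] unfolding mdeg_superset[OF finite_lessThan keys_x] sum_distrib_right[symmetric]
      by (simp only: mult.commute)
    ultimately show "homogeneous (e * D) (M a)" by (simp only:)
  qed
  obtain c a0 where a0: "a0 \<in> A" "c a0 \<noteq> 0"
    and c: "\<forall>b\<in>B. (\<Sum>a\<in>A. Poly_Mapping.lookup (M a) b * c a) = 0"
    using more_unknowns_than_equations[OF fin B(1) less, of "\<lambda>a b. Poly_Mapping.lookup (M a) b"] by blast
  have rel: "(\<Sum>a\<in>A. Const (c a) * M a) = 0"
  proof (rule poly_mapping_eqI)
    fix b
    have "(\<Sum>a\<in>A. c a * Poly_Mapping.lookup (M a) b) = 0"
    proof (cases "b \<in> B")
      case True
      then show ?thesis using c by (simp add: mult.commute)
    next
      case False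
      then have "Poly_Mapping.lookup (M a) b = 0" if "a \<in> A" for a
        using M[OF that] unfolding B_def mpolys_iff homogeneous_iff by blast
      then show ?thesis by simp
    qed
    then show "Poly_Mapping.lookup (\<Sum>a\<in>A. Const (c a) * M a) b = Poly_Mapping.lookup 0 b"
      by (simp add: lookup_sum)
  qed
  define h where "h = (\<Sum>a\<in>A. Poly_Mapping.single (x a) (c a))"
  show ?thesis
  proof (rule that)
    have "Poly_Mapping.lookup h (x a0) = (\<Sum>a\<in>A. if a = a0 then c a0 else 0)"
      unfolding h_def lookup_sum using inj_onD[OF inj_x _ _ a0(1)]
      by (intro sum.cong) (auto simp: lookup_single when_def)
    then have "Poly_Mapping.lookup h (x a0) \<noteq> 0" using a0 fin by simp
    then show "h \<noteq> 0" by auto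
    show "h \<in> mpolys (Suc (Suc m))" unfolding h_def
      by (intro mpolys_sum) (use keys_x in \<open>auto simp: mpolys_iff lookup_single when_def\<close>)
    show "homogeneous D h" unfolding h_def
      by (intro homogeneous_sum) (use deg_x in \<open>auto simp: homogeneous_iff lookup_single when_def\<close>)
    fix s
    have "peval (\<lambda>r. peval s (P r)) h =
        (\<Sum>a\<in>A. c a * (\<Prod>r<Suc (Suc m). peval s (P r) ^ Poly_Mapping.lookup (x a) r))"
      unfolding h_def peval_sum peval_single
      by (intro sum.cong refl arg_cong2[where f = "(*)"] prod_power_superset keys_x) simp_all
    also have "\<dots> = peval s (\<Sum>a\<in>A. Const (c a) * M a)"
      by (simp only: peval_sum peval_mult peval_Const M_def peval_prod peval_power)
    finally show "peval (\<lambda>r. peval s (P r)) h = 0" by (simp add: rel)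
  qed
qed

section \<open>The Jacobian criterion\<close>

text \<open>If a form \<open>h\<close> vanishes on the image of \<open>G\<close>, the chain rule shows that the gradient of \<open>h\<close>, taken along \<open>G\<close>, is
  in the kernel of the transposed Jacobian matrix. It is zero where the Jacobian determinant is nonzero, and
  therefore everywhere. So all partial derivatives of \<open>h\<close> vanish on the image as well, and induction on the degree
  applies.\<close>

lemma jacobian_criterion:
  fixes G :: "(nat \<Rightarrow> complex) \<Rightarrow> nat \<Rightarrow> complex"
  assumes deriv: "\<And>s r k. r < m \<Longrightarrow> k < m \<Longrightarrow>
      ((\<lambda>t. G (\<lambda>i. s i + t * (if i = k then 1 else 0)) r) has_field_derivative G' s r k) (at 0)"
    and lp: "\<And>r. line_poly (\<lambda>s. G s r)"
    and lp': "\<And>r k. r < m \<Longrightarrow> k < m \<Longrightarrow> line_poly (\<lambda>s. G' s r k)"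
    and det: "det (mat m m (\<lambda>(r, k). G' p r k)) \<noteq> 0"
    and h: "h \<in> mpolys m" "homogeneous D h" "\<And>s. peval (G s) h = 0"
  shows "h = 0"
  using h
proof (induction D arbitrary: h)
  case 0
  have "Poly_Mapping.lookup h 0 = peval (\<lambda>i. 0 * G p i) h" by (simp add: peval_at_0)
  also have "\<dots> = 0" using peval_scale[OF 0(2), of 0 "G p"] 0(3)[of p] by simp
  finally show ?case using 0(2) unfolding homogeneous_iff mdeg_eq_0_iff
    by (intro poly_mapping_eqI) (metis lookup_zero)
next
  case (Suc D)
  define J where "J s = det (mat m m (\<lambda>(k, r). G' s r k))" for s
  have Jp: "J p \<noteq> 0" using det det_mat_swap[of m "G' p"] by (simp add: J_def)
  have "line_poly (\<lambda>s. det (mat m m (\<lambda>(k, r). G' s r k)))" by (intro line_poly_det lp')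
  then have lpJ: "line_poly J" by (simp only: J_def[abs_def])
  have "peval (G s) (pdiff r h) = 0" if r: "r < m" for s r
  proof (rule ccontr)
    assume "peval (G s) (pdiff r h) \<noteq> 0"
    moreover have "line_poly (\<lambda>s. peval (G s) (pdiff r h))" by (intro line_poly_peval lp)
    ultimately obtain u where u: "peval (G u) (pdiff r h) \<noteq> 0" "J u \<noteq> 0"
      using line_poly_common_nonzero lpJ Jp by blast
    have "(\<Sum>r<m. G' u r k * peval (G u) (pdiff r h)) = 0" if k: "k < m" for k
    proof -
      have "((\<lambda>t. peval (G (\<lambda>i. u i + t * (if i = k then 1 else 0))) h) has_field_derivative
          (\<Sum>r<m. peval (G (\<lambda>i. u i + 0 * (if i = k then 1 else 0))) (pdiff r h) * G' u r k)) (at 0)"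
        by (rule peval_chain_rule[OF Suc.prems(1)]) (rule deriv[OF _ k])
      then have "((\<lambda>t. 0) has_field_derivative (\<Sum>r<m. peval (G u) (pdiff r h) * G' u r k)) (at 0)"
        by (simp add: Suc.prems(3))
      then have "(\<Sum>r<m. peval (G u) (pdiff r h) * G' u r k) = 0"
        by (rule DERIV_unique[OF _ DERIV_const])
      then show ?thesis by (simp add: mult.commute)
    qed
    then have "J u = 0" unfolding J_def det_mat_eq_0_iff using u(1) r
      by (intro exI[of _ "\<lambda>r. peval (G u) (pdiff r h)"]) blast
    with u(2) show False by simp
  qed
  moreover have "pdiff r h \<in> mpolys m" "homogeneous D (pdiff r h)" for r
    using act_in_mpolys[OF Suc.prems(1), of "Var r"] homogeneous_act[OF homogeneous_Var Suc.prems(2), of r]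
    by (simp_all add: act_Var)
  ultimately have "pdiff r h = 0" if "r < m" for r using that Suc.IH by blast
  then show ?case by (intro homogeneous_pdiff_eq_0[OF Suc.prems(2) _ Suc.prems(1)]) auto
qed

section \<open>Irreducible closed sets in projective space\<close>

lemma proj_pt_self: "v \<in> proj_pt v"
  unfolding proj_pt_def by (rule CollectI, rule exI[of _ 1]) simp

lemma closedin_zero_locus:
  assumes "\<forall>g\<in>S. g \<in> mpolys N \<and> (\<exists>e. homogeneous e g)"
  shows "closedin (zariski N) (zero_locus N S)"
  unfolding closedin_def topspace_zariski openin_zariski zariski_open_def
  using assms by (auto simp: zero_locus_def)

lemma proj_pt_in_zero_locus:
  assumes "v \<in> hcoords N" "\<And>g. g \<in> S \<Longrightarrow> \<exists>e. homogeneous e g"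
  shows "proj_pt v \<in> zero_locus N S \<longleftrightarrow> (\<forall>g\<in>S. peval v g = 0)"
proof
  assume "proj_pt v \<in> zero_locus N S"
  then show "\<forall>g\<in>S. peval v g = 0" using proj_pt_self[of v] unfolding zero_locus_def by blast
next
  assume *: "\<forall>g\<in>S. peval v g = 0"
  have "peval (\<lambda>i. c * v i) g = 0" if "g \<in> S" for c g
    using assms(2)[OF that] * that by (auto simp: peval_scale)
  then show "proj_pt v \<in> zero_locus N S"
    using assms(1) by (auto simp: zero_locus_def proj_def proj_pt_def)
qed

lemma zariski_closed_separation:
  assumes "closedin (zariski N) C" "u \<in> hcoords N" "proj_pt u \<notin> C"
  obtains g where "peval u g \<noteq> 0" "\<And>v. v \<in> hcoords N \<Longrightarrow> proj_pt v \<in> C \<Longrightarrow> peval v g = 0"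
proof -
  have C: "C \<subseteq> proj N" and "zariski_open N (proj N - C)"
    using assms(1) by (auto simp: closedin_def topspace_zariski openin_zariski)
  then obtain S where S: "\<forall>g\<in>S. g \<in> mpolys N \<and> (\<exists>e. homogeneous e g)"
      "proj N - C = proj N - zero_locus N S"
    unfolding zariski_open_def by blast
  have CS: "C = zero_locus N S" using C S(2) by (auto simp: zero_locus_def)
  then obtain g where g: "g \<in> S" "peval u g \<noteq> 0"
    using assms(2,3) proj_pt_in_zero_locus[of u N S] S(1) by blast
  show ?thesis
  proof (rule that[OF g(2)])
    fix v assume "v \<in> hcoords N" "proj_pt v \<in> C"
    then show "peval v g = 0" using g(1) proj_pt_in_zero_locus[of v N S] S(1) CS by blast
  qed
qed

text \<open>If the closure were a union of two smaller closed sets, there would be forms \<open>g\<close> and \<open>h\<close> that vanish on one of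
  them each but not on the whole image. Their pullbacks along \<open>\<gamma>\<close> are nonzero polynomial functions, so some
  parameter \<open>w\<close> has \<open>g(\<gamma> w) \<noteq> 0\<close> and \<open>h(\<gamma> w) \<noteq> 0\<close>, and its image point lies in neither set.\<close>

lemma irreducible_closure_of_image:
  fixes \<gamma> :: "(nat \<Rightarrow> complex) \<Rightarrow> nat \<Rightarrow> complex" and N :: nat
  defines "Img \<equiv> proj_pt ` (range \<gamma> \<inter> hcoords N)"
  assumes lp: "\<And>i. line_poly (\<lambda>s. \<gamma> s i)"
    and supp: "\<And>s i. i \<ge> N \<Longrightarrow> \<gamma> s i = 0"
    and ne: "Img \<noteq> {}"
    and Y: "closedin (zariski N) Y" "Img \<subseteq> Y"
  shows "irreducible_closedin (subtopology (zariski N) Y) (zariski N closure_of Img)"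
proof -
  let ?X = "zariski N"
  let ?Z = "?X closure_of Img"
  have Img: "Img \<subseteq> topspace ?X" by (auto simp: Img_def topspace_zariski proj_def)
  have ImZ: "Img \<subseteq> ?Z" by (rule closure_of_subset[OF Img])
  have closed: "closedin (subtopology ?X Y) C \<longleftrightarrow> closedin ?X C \<and> C \<subseteq> Y" for C
    by (rule closedin_closed_subtopology[OF Y(1)])
  have "closedin (subtopology ?X Y) ?Z"
    unfolding closed using closure_of_minimal[OF Y(2,1)] by simp
  moreover have "?Z \<noteq> {}" using ne ImZ by blast
  moreover have "?Z = C \<or> ?Z = E"
    if CE: "closedin (subtopology ?X Y) C" "closedin (subtopology ?X Y) E" "?Z = C \<union> E" for C E
  proof (rule ccontr)
    assume neq: "\<not> (?Z = C \<or> ?Z = E)"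
    have sep: "\<exists>g s. line_poly (\<lambda>s. peval (\<gamma> s) g) \<and> \<gamma> s \<in> hcoords N \<and> peval (\<gamma> s) g \<noteq> 0 \<and>
        (\<forall>v\<in>hcoords N. proj_pt v \<in> C \<longrightarrow> peval v g = 0)"
      if C: "closedin ?X C" "C \<subseteq> ?Z" "?Z \<noteq> C" for C
    proof -
      have "\<not> Img \<subseteq> C" using closure_of_minimal[of Img C ?X] C by blast
      then obtain s where s: "\<gamma> s \<in> hcoords N" "proj_pt (\<gamma> s) \<notin> C" by (auto simp: Img_def)
      obtain g where "peval (\<gamma> s) g \<noteq> 0" "\<And>v. v \<in> hcoords N \<Longrightarrow> proj_pt v \<in> C \<Longrightarrow> peval v g = 0"
        by (rule zariski_closed_separation[OF C(1) s]) blast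
      moreover have "line_poly (\<lambda>s. peval (\<gamma> s) g)" by (intro line_poly_peval lp)
      ultimately show ?thesis using s(1) by blast
    qed
    obtain g s where g: "line_poly (\<lambda>s. peval (\<gamma> s) g)" "\<gamma> s \<in> hcoords N" "peval (\<gamma> s) g \<noteq> 0"
        "\<forall>v\<in>hcoords N. proj_pt v \<in> C \<longrightarrow> peval v g = 0"
      using sep[of C] CE neq unfolding closed by blast
    obtain h s' where h: "line_poly (\<lambda>s. peval (\<gamma> s) h)" "peval (\<gamma> s') h \<noteq> 0"
        "\<forall>v\<in>hcoords N. proj_pt v \<in> E \<longrightarrow> peval v h = 0"
      using sep[of E] CE neq unfolding closed by blast
    \<comment> \<open>A coordinate of \<open>\<gamma>\<close> is kept nonzero too, so that \<open>\<gamma> w\<close> is a point of projective space; this is not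
       implied by \<open>g(\<gamma> w) \<noteq> 0\<close> if \<open>g\<close> is constant.\<close>
    obtain i where i: "\<gamma> s i \<noteq> 0" using g(2) by (auto simp: hcoords_def)
    obtain u where u: "peval (\<gamma> u) g \<noteq> 0" "peval (\<gamma> u) h \<noteq> 0"
      using line_poly_common_nonzero[OF g(1) h(1) g(3) h(2)] by blast
    then obtain w where w: "peval (\<gamma> w) g * peval (\<gamma> w) h \<noteq> 0" "\<gamma> w i \<noteq> 0"
      using line_poly_common_nonzero[OF line_poly_mult[OF g(1) h(1)] lp[of i], of u s] i by auto
    have "\<gamma> w \<in> hcoords N" using w(2) supp by (auto simp: hcoords_def)
    moreover from this have "proj_pt (\<gamma> w) \<in> C \<union> E"
      using ImZ CE(3) by (auto simp: Img_def)
    ultimately show False using g(4) h(3) w(1) by auto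
  qed
  ultimately show ?thesis unfolding irreducible_closedin_def by blast
qed

section \<open>The dimension of the polar image\<close>

text \<open>The point with parameters \<open>s\<close> in the subspace spanned by \<open>(1, c\<^sub>1, \<dots>, c\<^sub>n)\<close> and the unit vectors
  \<open>e\<^sub>1, \<dots>, e\<^sub>i\<close>. It is parametrised by its first \<open>i + 1\<close> coordinates; so \<open>s\<close> also serves as its own parameter
  vector when it already lies in the subspace.\<close>

definition flag_point :: "nat \<Rightarrow> (nat \<Rightarrow> complex) \<Rightarrow> nat \<Rightarrow> (nat \<Rightarrow> complex) \<Rightarrow> nat \<Rightarrow> complex" where
  "flag_point n c i s = (\<lambda>l. if l \<le> i then s l else if l \<le> n then s 0 * c l else 0)"

text \<open>The matrix of \<^const>\<open>flag_point\<close>, used to restrict forms to the subspace as polynomials in \<open>i + 1\<close> variables.\<close>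

definition flag_mat :: "nat \<Rightarrow> (nat \<Rightarrow> complex) \<Rightarrow> nat \<Rightarrow> complex mat" where
  "flag_mat n c i = mat (Suc n) (Suc i)
     (\<lambda>(l, r). if l \<le> i then (if r = l then 1 else 0) else (if r = 0 then c l else 0))"

lemma line_poly_flag_point: "line_poly (\<lambda>s. flag_point n c i s l)"
  by (cases "l \<le> i"; cases "l \<le> n")
    (simp_all add: flag_point_def line_poly_coord line_poly_const line_poly_mult)

lemma peval_lin_subst_flag_mat:
  assumes "F \<in> mpolys (Suc n)"
  shows "peval s (lin_subst (flag_mat n c i) F) = peval (flag_point n c i s) F"
  unfolding peval_lin_subst
proof (rule peval_cong[OF assms])
  fix l assume l: "l < Suc n"
  have "(\<Sum>r<dim_col (flag_mat n c i). flag_mat n c i $$ (l, r) * s r) =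
      (\<Sum>r<Suc i. if l \<le> i then (if r = l then s l else 0) else (if r = 0 then s 0 * c l else 0))"
    using l by (intro sum.cong) (auto simp: flag_mat_def)
  also have "\<dots> = flag_point n c i s l"
    using l by (cases "l \<le> i") (simp_all add: flag_point_def del: sum.lessThan_Suc)
  finally show "(\<Sum>r<dim_col (flag_mat n c i). flag_mat n c i $$ (l, r) * s r) = flag_point n c i s l" .
qed

lemma flag_point_superposition:
  "flag_point n c i w x = (\<Sum>r<Suc i. w r * flag_point n c i (\<lambda>l. if l = r then 1 else 0) x)"
proof -
  have "(\<Sum>r<Suc i. w r * flag_point n c i (\<lambda>l. if l = r then 1 else 0) x) =
      (\<Sum>r<Suc i. if x \<le> i then (if r = x then w x else 0)
         else if x \<le> n then (if r = 0 then w 0 * c x else 0) else 0)"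
    by (intro sum.cong) (auto simp: flag_point_def)
  also have "\<dots> = flag_point n c i w x"
    by (cases "x \<le> i") (simp_all add: flag_point_def del: sum.lessThan_Suc)
  finally show ?thesis by simp
qed

definition flag_image_coords ::
  "nat \<Rightarrow> nat \<Rightarrow> (nat \<Rightarrow> mpoly) \<Rightarrow> (nat \<Rightarrow> complex) \<Rightarrow> nat \<Rightarrow> (nat \<Rightarrow> complex) \<Rightarrow> nat \<Rightarrow> complex"
  where "flag_image_coords n N F p i s =
    (\<lambda>l. if l < N then peval (flag_point n (\<lambda>l. p l / p 0) i s) (F l) else 0)"

definition flag_image ::
  "nat \<Rightarrow> nat \<Rightarrow> (nat \<Rightarrow> mpoly) \<Rightarrow> (nat \<Rightarrow> complex) \<Rightarrow> nat \<Rightarrow> (nat \<Rightarrow> complex) set set"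
  where "flag_image n N F p i = proj_pt ` (range (flag_image_coords n N F p i) \<inter> hcoords N)"

context
  fixes n N e :: nat and F :: "nat \<Rightarrow> mpoly" and p :: "nat \<Rightarrow> complex"
  assumes F: "\<And>l. l < N \<Longrightarrow> F l \<in> mpolys (Suc n) \<and> homogeneous e (F l)"
    and p0: "p 0 \<noteq> 0"
    and inj: "\<And>w. (\<And>l. l < N \<Longrightarrow> peval p (act (linear_form (Suc n) w) (F l)) = 0)
      \<Longrightarrow> \<forall>i\<le>n. w i = 0"
begin

abbreviation (input) \<psi> :: "nat \<Rightarrow> (nat \<Rightarrow> complex) \<Rightarrow> nat \<Rightarrow> complex" where
  "\<psi> \<equiv> flag_point n (\<lambda>l. p l / p 0)"

abbreviation (input) flag_coords :: "nat \<Rightarrow> (nat \<Rightarrow> complex) \<Rightarrow> nat \<Rightarrow> complex" where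
  "flag_coords \<equiv> flag_image_coords n N F p"

abbreviation (input) flag_img :: "nat \<Rightarrow> (nat \<Rightarrow> complex) set set" where
  "flag_img \<equiv> flag_image n N F p"

lemma flag_point_base: "l \<le> n \<Longrightarrow> \<psi> i p l = p l"
  using p0 by (simp add: flag_point_def)

text \<open>By Euler's formula, \<open>p\<close> would otherwise be a nonzero vector in the kernel of the Jacobian matrix.\<close>

lemma flag_image_base_nonzero: "\<exists>l<N. flag_coords i p l \<noteq> 0"
proof (rule ccontr)
  assume *: "\<not> ?thesis"
  have "peval p (act (linear_form (Suc n) p) (F l)) = 0" if l: "l < N" for l
  proof -
    have "peval p (F l) = peval (\<psi> i p) (F l)"
      using F[OF l] by (intro peval_cong[of _ "Suc n"]) (auto simp: flag_point_base)
    also have "\<dots> = 0" using * l by (auto simp: flag_image_coords_def)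
    finally show ?thesis using euler_formula[of e "F l" "Suc n" p] F[OF l] by simp
  qed
  then have "\<forall>i\<le>n. p i = 0" by (rule inj)
  with p0 show False by simp
qed

text \<open>The Jacobian matrix \<open>J\<close> of the coordinate forms restricted to the subspace of dimension \<open>i + 2\<close> is injective at
  \<open>p\<close>. The combinations \<open>G\<close> of the forms with coefficients from \<open>J\<^sup>*\<close> have the Jacobian matrix \<open>J\<^sup>* J\<close> at
  \<open>p\<close>, which is invertible. A relation \<open>h\<close> between the restrictions of \<open>G\<close> to the subspace of dimension
  \<open>i + 1\<close> is therefore not a relation on the larger one, and substituting the combinations into \<open>h\<close> gives \<open>H\<close>.\<close>

lemma flag_step_separating_form:
  assumes i: "i < n"
  obtains H D where "H \<in> mpolys N" "homogeneous D H"
    "\<And>s. peval (flag_coords i s) H = 0" "\<exists>s. peval (flag_coords (Suc i) s) H \<noteq> 0"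
proof -
  let ?m = "Suc (Suc i)"
  define E where "E k = \<psi> (Suc i) (\<lambda>l. if l = k then 1 else 0)" for k
  define J where "J s l k = peval (\<psi> (Suc i) s) (act (linear_form (Suc n) (E k)) (F l))" for s l k
  define G where "G s r = (\<Sum>l<N. cnj (J p l r) * peval (\<psi> (Suc i) s) (F l))" for s r
  define G' where "G' s r k = (\<Sum>l<N. cnj (J p l r) * J s l k)" for s r k
  have det: "det (mat ?m ?m (\<lambda>(r, k). G' p r k)) \<noteq> 0"
    unfolding G'_def
  proof (rule gram_det_nonzero)
    fix w assume w: "\<And>l. l \<in> {..<N} \<Longrightarrow> (\<Sum>k<?m. J p l k * w k) = 0"
    have "peval p (act (linear_form (Suc n) (\<psi> (Suc i) w)) (F l)) = 0" if l: "l < N" for l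
    proof -
      have "peval p (act (linear_form (Suc n) (\<psi> (Suc i) w)) (F l)) =
          (\<Sum>x<Suc n. (\<Sum>k<?m. w k * E k x) * peval p (pdiff x (F l)))"
        unfolding peval_act_linear_form E_def flag_point_superposition[symmetric] by simp
      also have "\<dots> = (\<Sum>k<?m. (\<Sum>x<Suc n. E k x * peval p (pdiff x (F l))) * w k)"
        unfolding sum_distrib_left sum_distrib_right by (subst sum.swap) (simp only: mult_ac)
      also have "\<dots> = (\<Sum>k<?m. J p l k * w k)"
      proof (rule sum.cong[OF refl])
        fix k
        have "act (linear_form (Suc n) (E k)) (F l) \<in> mpolys (Suc n)"
          using F[OF l] by (intro act_in_mpolys) simp
        then have "J p l k = peval p (act (linear_form (Suc n) (E k)) (F l))"
          unfolding J_def by (rule peval_cong) (simp add: flag_point_base)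
        then show "(\<Sum>x<Suc n. E k x * peval p (pdiff x (F l))) * w k = J p l k * w k"
          by (simp only: peval_act_linear_form)
      qed
      finally show ?thesis using w l by simp
    qed
    then have "\<forall>x\<le>n. \<psi> (Suc i) w x = 0" by (rule inj)
    then have "\<psi> (Suc i) w k = 0" if "k < ?m" for k using i that by auto
    then show "\<forall>k<?m. w k = 0" by (simp add: flag_point_def)
  qed simp
  define P where "P r = (\<Sum>l<N. Const (cnj (J p l r)) * lin_subst (flag_mat n (\<lambda>l. p l / p 0) i) (F l))" for r
  have "P r \<in> mpolys (Suc i) \<and> homogeneous e (P r)" for r
    unfolding P_def
  proof (intro conjI mpolys_sum mpolys_mult mpolys_Const homogeneous_sum homogeneous_Const_mult homogeneous_lin_subst)
    fix l assume "l \<in> {..<N}"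
    then show "homogeneous e (F l)" using F by simp
    show "lin_subst (flag_mat n (\<lambda>l. p l / p 0) i) (F l) \<in> mpolys (Suc i)"
      using lin_subst_in_mpolys[of "flag_mat n (\<lambda>l. p l / p 0) i" "F l"] by (simp add: flag_mat_def)
  qed
  then obtain h D where h: "h \<noteq> 0" "h \<in> mpolys ?m" "homogeneous D h"
      and rel: "\<And>s. peval (\<lambda>r. peval s (P r)) h = 0"
    by (rule forms_algebraically_dependent[of i P e]) blast
  have P: "peval s (P r) = (\<Sum>l<N. cnj (J p l r) * peval (\<psi> i s) (F l))" for s r
    unfolding P_def peval_sum peval_mult peval_Const
    using F by (intro sum.cong) (auto simp: peval_lin_subst_flag_mat)
  define M where "M = mat ?m N (\<lambda>(r, l). cnj (J p l r))"
  have M: "peval v (lin_subst M h) = peval (\<lambda>r. \<Sum>l<N. cnj (J p l r) * v l) h" for v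
    unfolding peval_lin_subst by (rule peval_cong[OF h(2)]) (simp add: M_def)
  have flag: "(\<Sum>l<N. cnj (J p l r) * flag_coords k s l) =
      (\<Sum>l<N. cnj (J p l r) * peval (\<psi> k s) (F l))" for k r s
    by (rule sum.cong) (auto simp: flag_image_coords_def)
  show ?thesis
  proof (rule that)
    show "lin_subst M h \<in> mpolys N" using lin_subst_in_mpolys[of M h] by (simp add: M_def)
    show "homogeneous D (lin_subst M h)" by (rule homogeneous_lin_subst[OF h(3)])
    show "peval (flag_coords i s) (lin_subst M h) = 0" for s
      using rel[of s] by (simp only: M flag P)
    show "\<exists>s. peval (flag_coords (Suc i) s) (lin_subst M h) \<noteq> 0"
    proof (rule ccontr)
      assume "\<not> ?thesis"
      then have van: "peval (G s) h = 0" for s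
        using M[of "flag_coords (Suc i) s"] unfolding flag G_def[symmetric] by simp
      have "h = 0"
      proof (rule jacobian_criterion[where G = G and G' = G' and p = p, OF _ _ _ det h(2,3) van])
        fix s r k
        show "((\<lambda>t. G (\<lambda>i. s i + t * (if i = k then 1 else 0)) r) has_field_derivative G' s r k) (at 0)"
          unfolding G_def G'_def
        proof (intro DERIV_sum DERIV_cmult)
          fix l assume "l \<in> {..<N}"
          then have Fl: "F l \<in> mpolys (Suc n)" using F by simp
          have lin: "\<psi> (Suc i) (\<lambda>j. s j + t * (if j = k then 1 else 0)) =
              (\<lambda>x. \<psi> (Suc i) s x + t * E k x)" for t
            by (rule ext) (simp add: E_def flag_point_def algebra_simps add_divide_distrib)
          show "((\<lambda>t. peval (\<psi> (Suc i) (\<lambda>i. s i + t * (if i = k then 1 else 0))) (F l))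
              has_field_derivative J s l k) (at 0)"
            using peval_line_deriv[OF Fl, of "\<psi> (Suc i) s" "E k" 0] by (simp add: lin J_def)
        qed
        show "line_poly (\<lambda>s. G s r)" unfolding G_def
          by (intro line_poly_sum line_poly_mult line_poly_const line_poly_peval line_poly_flag_point)
        show "line_poly (\<lambda>s. G' s r k)" unfolding G'_def J_def
          by (intro line_poly_sum line_poly_mult line_poly_const line_poly_peval line_poly_flag_point)
      qed
      with h(1) show False by simp
    qed
  qed
qed

lemma flag_image_coords_in_hcoords:
  "flag_coords i s l \<noteq> 0 \<Longrightarrow> flag_coords i s \<in> hcoords N"
  by (auto simp: hcoords_def) (simp add: flag_image_coords_def)

lemma flag_image_nonempty: "flag_img i \<noteq> {}"
  using flag_image_base_nonzero[of i] flag_image_coords_in_hcoords[of i p] by (auto simp: flag_image_def)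

lemma flag_image_mono: "flag_img i \<subseteq> flag_img (Suc i)"
proof -
  have "flag_coords i s = flag_coords (Suc i) (\<psi> i s)" for s
  proof -
    have "\<psi> (Suc i) (\<psi> i s) = \<psi> i s" by (auto simp: flag_point_def)
    then show ?thesis unfolding flag_image_coords_def by presburger
  qed
  then have "range (flag_coords i) \<subseteq> range (flag_coords (Suc i))" by blast
  then show ?thesis unfolding flag_image_def by blast
qed

text \<open>The form \<open>H\<close> cuts out a closed set that contains the smaller image but not the larger one.\<close>

lemma flag_image_closure_strict:
  assumes "i < n"
  shows "zariski N closure_of flag_img i \<subset> zariski N closure_of flag_img (Suc i)"
proof -
  obtain H D where H: "H \<in> mpolys N" "homogeneous D H"
      and van: "\<And>s. peval (flag_coords i s) H = 0"
      and "\<exists>s. peval (flag_coords (Suc i) s) H \<noteq> 0"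
    by (rule flag_step_separating_form[OF assms]) blast
  then obtain s where s: "peval (flag_coords (Suc i) s) H \<noteq> 0" by blast
  have pt: "proj_pt v \<in> zero_locus N {H} \<longleftrightarrow> peval v H = 0" if "v \<in> hcoords N" for v
    using proj_pt_in_zero_locus[OF that, of "{H}"] H(2) by auto
  have "flag_img i \<subseteq> zero_locus N {H}" using van pt by (auto simp: flag_image_def)
  then have "zariski N closure_of flag_img i \<subseteq> zero_locus N {H}"
    by (rule closure_of_minimal) (rule closedin_zero_locus, use H in auto)
  \<comment> \<open>\<open>H\<close> has a zero on the smaller image, so by homogeneity it vanishes at the origin.\<close>
  moreover have "flag_coords (Suc i) s \<in> hcoords N"
  proof (rule ccontr)
    assume "\<not> ?thesis"
    then have "flag_coords (Suc i) s = (\<lambda>l. 0 * flag_coords i s l)"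
      using flag_image_coords_in_hcoords by fastforce
    then show False using s peval_scale[OF H(2), of 0 "flag_coords i s"] van by simp
  qed
  then have mem: "proj_pt (flag_coords (Suc i) s) \<in> flag_img (Suc i)"
      and "proj_pt (flag_coords (Suc i) s) \<notin> zero_locus N {H}"
    using s pt by (auto simp: flag_image_def)
  moreover have "flag_img (Suc i) \<subseteq> topspace (zariski N)"
    by (auto simp: flag_image_def topspace_zariski proj_def)
  then have "flag_img (Suc i) \<subseteq> zariski N closure_of flag_img (Suc i)"
    by (rule closure_of_subset)
  ultimately show ?thesis using closure_of_mono[OF flag_image_mono[of i], of "zariski N"] by blast
qed

lemma krull_dim_ge:
  assumes Y: "closedin (zariski N) Y" "flag_img n \<subseteq> Y"
  shows "enat n \<le> krull_dim (subtopology (zariski N) Y)"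
proof -
  define Z where "Z i = (zariski N) closure_of (flag_img i)" for i
  have "irreducible_closedin (subtopology (zariski N) Y) (Z i)" if "i \<le> n" for i
    unfolding Z_def flag_image_def
  proof (rule irreducible_closure_of_image)
    show "line_poly (\<lambda>s. flag_coords i s l)" for l
      by (cases "l < N") (simp_all add: flag_image_coords_def line_poly_const line_poly_peval line_poly_flag_point)
    have "flag_img i \<subseteq> flag_img n"
      using flag_image_mono that by (rule lift_Suc_mono_le[where f = flag_img])
    then show "proj_pt ` (range (flag_coords i) \<inter> hcoords N) \<subseteq> Y"
      using Y(2) by (simp add: flag_image_def)
  qed (use flag_image_nonempty Y in \<open>auto simp: flag_image_coords_def flag_image_def\<close>)
  moreover have "Z i \<subset> Z (Suc i)" if "i < n" for i
    unfolding Z_def by (rule flag_image_closure_strict[OF that])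
  ultimately show ?thesis unfolding krull_dim_def by (intro Sup_upper) blast
qed

end

theorem corollary5p3:
  fixes n d k j :: nat and f :: mpoly and bs :: "mpoly set list"
  assumes "n \<ge> 1" and "d \<ge> 2"
    and "f \<in> mpolys (Suc n)" and "homogeneous d f" and "\<not> is_cone n f"
    and "k = (GREATEST i. 1 \<le> i \<and> i \<le> d div 2 \<and> injective_mult_into n f i)"
    and "1 \<le> j" and "j \<le> k"
    and "A_deg_basis n f j bs"
    and "polar_degenerated n f bs"
  shows "hess n f bs = 0"
proof (rule ccontr)
  assume hess: "hess n f bs \<noteq> 0"
  let ?P = "\<lambda>i. 1 \<le> i \<and> i \<le> d div 2 \<and> injective_mult_into n f i"
  have "?P 1" using injective_mult_into_one[OF assms(3,5)] assms(2) by auto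
  then have "?P k" unfolding assms(6) by (rule GreatestI_nat[where b = "d div 2"]) auto
  then have k: "2 * k \<le> d" "injective_mult_into n f k" by auto
  let ?N = "length bs"
  let ?F = "\<lambda>l. A_act (bs ! l) f"
  obtain p where p: "p 0 \<noteq> 0"
    "\<And>w. (\<And>l. l < ?N \<Longrightarrow> peval p (act (linear_form (Suc n) w) (?F l)) = 0) \<Longrightarrow> \<forall>i\<le>n. w i = 0"
    by (rule polar_jacobian_injective[OF assms(3,4,5,7,8) k assms(9) hess]) blast
  obtain al where al: "\<And>i. i < ?N \<Longrightarrow>
      al i \<in> mpolys (Suc n) \<and> homogeneous j (al i) \<and> bs ! i = A_class n f (al i)"
    by (rule A_deg_basis_representatives[OF assms(9)]) blast
  have F: "?F l \<in> mpolys (Suc n) \<and> homogeneous (d - j) (?F l)" if "l < ?N" for l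
    using al[OF that] act_in_mpolys[OF assms(3)] homogeneous_act[OF _ assms(4)] by simp
  have e: "d - j > 0" using assms(2,8) k(1) by linarith
  have "enat n \<le> krull_dim (subtopology (zariski ?N) (polar_variety n f bs))"
  proof (rule krull_dim_ge[of ?N ?F n "d - j" p])
    show "closedin (zariski ?N) (polar_variety n f bs)"
      unfolding polar_variety_def by (rule closedin_closure_of)
    have "flag_image n ?N ?F p n \<subseteq> polar_image n f bs"
    proof
      fix Q assume "Q \<in> flag_image n ?N ?F p n"
      then obtain s where Q: "Q = proj_pt (flag_image_coords n ?N ?F p n s)"
          and h: "flag_image_coords n ?N ?F p n s \<in> hcoords ?N"
        by (auto simp: flag_image_def)
      let ?v = "flag_point n (\<lambda>l. p l / p 0) n s"
      have eq: "flag_image_coords n ?N ?F p n s = polar_coords f bs ?v"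
        by (auto simp: flag_image_coords_def polar_coords_def)
      \<comment> \<open>The coordinate forms have positive degree, hence vanish at the origin.\<close>
      have "?v \<noteq> (\<lambda>_. 0)"
      proof
        assume v: "?v = (\<lambda>_. 0)"
        have "peval (\<lambda>i. 0 * 0) (?F l) = 0" if "l < ?N" for l
          using peval_scale[of "d - j" "?F l" 0 "\<lambda>_. 0"] F[OF that] e by (simp add: zero_power)
        then have "polar_coords f bs ?v = (\<lambda>_. 0)" by (auto simp: polar_coords_def v)
        with h show False by (simp add: eq hcoords_def)
      qed
      then have "?v \<in> hcoords (Suc n)" by (auto simp: hcoords_def flag_point_def)
      then show "Q \<in> polar_image n f bs"
        using h unfolding Q eq polar_image_def by blast
    qed
    also have "polar_image n f bs \<subseteq> polar_variety n f bs"
      unfolding polar_variety_def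
      by (rule closure_of_subset) (auto simp: polar_image_def topspace_zariski proj_def)
    finally show "flag_image n ?N ?F p n \<subseteq> polar_variety n f bs" .
  qed (use F p in auto)
  with assms(10) show False by (simp add: polar_degenerated_def)
qed

end
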